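(* Let $q>0$ and $\mu=(\mu_1,\dots,\mu_q)\in((\mathbb R^2)^* )^q$. Let $G$ be either $\mathrm{Osc}^2_q(\mu)$, where additionally all $\mu_j\neq0$ and $\{\mu_1,\dots,\mu_q\}$ is not contained in a union of two one-dimensional subspaces of $(\mathbb R^2)^*$, or $D_q(\mu)$, where additionally all $\mu_j\ne0$. Then $G$ admits a lattice (a discrete cocompact subgroup) if and only if $\mu_1,\dots,\mu_q$ are all contained in some lattice (a discrete subgroup of rank 2) of $(\mathbb R^2)^*$. Moreover, the group $D_0$ admits a lattice.
   Context: Let $\mathfrak l=\mathbb R^2$, $\mathfrak z=\mathfrak l^*$, and $\mathfrak a^{2q}=\mathbb C^q$ with the Euclidean inner product $\langle z,w\rangle=\mathrm{Re}\sum_j z_j\bar w_j$. Let $\rho(t)(z_1,\dots,z_q)=i(\mu_1(t)z_1,\dots,\mu_q(t)z_q)$ for $t\in\mathfrak l$, and define $\omega(a,a')\in\mathfrak z$ by $\omega(a,a')(t)=\langle\rho(t)a,a'\rangle$. Definition of $\mathfrak{osc}^2_q(\mu)$: the Lie algebra on $\mathfrak z\oplus\mathfrak a^{2q}\oplus\mathfrak l$ with $\mathfrak z$ central and brackets $[\mathfrak l,\mathfrak l]=0$, $[t,a]=\rho(t)a$, $[a,a']=\omega(a,a')$. $\mathrm{Osc}^2_q(\mu)$ is its simply-connected Lie group. Definition of $\mathfrak d_q(\mu)$: let $\mathfrak a_0=\mathbb R$, $\alpha(t,t')=t_1t_2'-t_2t_1'$, and $t^\flat\in\mathfrak z$ with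 $t^\flat(t')=\alpha(t,t')$. Then $\mathfrak d_q(\mu)=\mathfrak z\oplus\mathfrak a^{2q}\oplus\mathfrak a_0\oplus\mathfrak l$ with the following brackets: $\mathfrak z$ is central; $[a,a']=\omega(a,a')$ for $a,a'\in\mathfrak a^{2q}$; $\mathfrak a_0$ commutes with $\mathfrak a^{2q}\oplus\mathfrak a_0$; $[t,z+a+s]=-s\,t^\flat+\rho(t)a$; and $[t,t']=\alpha(t,t')\in\mathfrak a_0$. $D_q(\mu)$ is its simply-connected Lie group, and $D_0$ denotes the case $q=0$, i.e. the Lie algebra $\mathfrak z\oplus\mathfrak a_0\oplus\mathfrak l$ with these brackets. *)

theory Defs
  imports "HOL-Analysis.Analysis"
begin

text \<open>
  l = R^2 is modelled by real^2.  Elements of z = l^* and the weights mu_j in (R^2)^*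
  are modelled by real^2 via the dual basis: a functional f is identified with the
  vector whose k-th entry is f(e_k); then f(t) = f \<bullet> t.
  a^{2q} = C^q is complex^'q with q = CARD('q); its inner product
  Re (sum_j z_j cnj w_j) is Isabelle's inner product on complex^'q.
\<close>

definition pair_l :: "real^2 \<Rightarrow> real^2 \<Rightarrow> real" where
  "pair_l f t = f \<bullet> t"

definition rho :: "('q::finite \<Rightarrow> real^2) \<Rightarrow> real^2 \<Rightarrow> complex^'q \<Rightarrow> complex^'q" where
  "rho \<mu> t a = (\<chi> j. \<i> * complex_of_real (pair_l (\<mu> j) t) * a $ j)"

text \<open>omega(a,a') in z, omega(a,a')(t) = <rho(t) a, a'>; stored by its values on e_1, e_2\<close>
definition omega :: "('q::finite \<Rightarrow> real^2) \<Rightarrow> complex^'q \<Rightarrow> complex^'q \<Rightarrow> real^2" where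
  "omega \<mu> a a' = (\<chi> k. (rho \<mu> (axis k 1) a) \<bullet> a')"

text \<open>exp(rho(t)) acting on C^q\<close>
definition rot :: "('q::finite \<Rightarrow> real^2) \<Rightarrow> real^2 \<Rightarrow> complex^'q \<Rightarrow> complex^'q" where
  "rot \<mu> t a = (\<chi> j. exp (\<i> * complex_of_real (pair_l (\<mu> j) t)) * a $ j)"

text \<open>Simply connected group of osc^2_q(mu), realised as the semidirect product
  H \<rtimes> R^2 of the Heisenberg group H (exponential coordinates on z + a^{2q})
  by l = R^2 acting via exp(ad t) = (z,a) \<mapsto> (z, exp(rho t) a).
  Elements are (z, a, t).\<close>
definition osc_mult :: "('q::finite \<Rightarrow> real^2) \<Rightarrow>
    ((real^2) \<times> (complex^'q) \<times> (real^2)) \<Rightarrow> ((real^2) \<times> (complex^'q) \<times> (real^2)) \<Rightarrow>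
    ((real^2) \<times> (complex^'q) \<times> (real^2))" where
  "osc_mult \<mu> x y = (case x of (z, a, t) \<Rightarrow> case y of (z', a', t') \<Rightarrow>
      (z + z' + (1/2) *\<^sub>R omega \<mu> a (rot \<mu> t a'), a + rot \<mu> t a', t + t'))"

definition osc_one :: "(real^2) \<times> (complex^'q) \<times> (real^2)" where
  "osc_one = (0, 0, 0)"

definition alpha :: "real^2 \<Rightarrow> real^2 \<Rightarrow> real" where
  "alpha t t' = t $ 1 * t' $ 2 - t $ 2 * t' $ 1"

text \<open>t^flat in z, t^flat(t') = alpha(t,t')\<close>
definition flat :: "real^2 \<Rightarrow> real^2" where
  "flat t = (\<chi> k. alpha t (axis k 1))"

text \<open>Lie bracket of d_0 = z + a_0 + l, elements (z, s, t)\<close>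
definition d0_br :: "((real^2) \<times> real \<times> (real^2)) \<Rightarrow> ((real^2) \<times> real \<times> (real^2)) \<Rightarrow>
    ((real^2) \<times> real \<times> (real^2))" where
  "d0_br x y = (case x of (z, s, t) \<Rightarrow> case y of (z', s', t') \<Rightarrow>
      (s *\<^sub>R flat t' - s' *\<^sub>R flat t, alpha t t', 0))"

text \<open>d_0 is 3-step nilpotent, so the Baker-Campbell-Hausdorff series terminates at
  order 3; D_0 is realised in exponential coordinates.\<close>
definition d0_mult :: "((real^2) \<times> real \<times> (real^2)) \<Rightarrow> ((real^2) \<times> real \<times> (real^2)) \<Rightarrow>
    ((real^2) \<times> real \<times> (real^2))" where
  "d0_mult x y = x + y + (1/2) *\<^sub>R d0_br x y
      + (1/12) *\<^sub>R d0_br x (d0_br x y) - (1/12) *\<^sub>R d0_br y (d0_br x y)"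

definition d0_one :: "(real^2) \<times> real \<times> (real^2)" where
  "d0_one = 0"

text \<open>Simply connected group of d_q(mu): the quotient of (Heisenberg group on z + a^{2q})
  \<rtimes> D_0 by the central antidiagonal copy of z.  Elements are ((z,s,t), a).\<close>
definition D_mult :: "('q::finite \<Rightarrow> real^2) \<Rightarrow>
    (((real^2) \<times> real \<times> (real^2)) \<times> (complex^'q)) \<Rightarrow> (((real^2) \<times> real \<times> (real^2)) \<times> (complex^'q)) \<Rightarrow>
    (((real^2) \<times> real \<times> (real^2)) \<times> (complex^'q))" where
  "D_mult \<mu> x y = (case x of (u, a) \<Rightarrow> case y of (u', a') \<Rightarrow>
      (d0_mult u u' + ((1/2) *\<^sub>R omega \<mu> a (rot \<mu> (snd (snd u)) a'), 0, 0),
       a + rot \<mu> (snd (snd u)) a'))"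

definition D_one :: "((real^2) \<times> real \<times> (real^2)) \<times> (complex^'q)" where
  "D_one = (0, 0)"

definition is_subgroup :: "('g \<Rightarrow> 'g \<Rightarrow> 'g) \<Rightarrow> 'g \<Rightarrow> 'g set \<Rightarrow> bool" where
  "is_subgroup gmult e \<Gamma> \<longleftrightarrow> e \<in> \<Gamma> \<and> (\<forall>x\<in>\<Gamma>. \<forall>y\<in>\<Gamma>. gmult x y \<in> \<Gamma>)
     \<and> (\<forall>x\<in>\<Gamma>. \<exists>y\<in>\<Gamma>. gmult x y = e)"

definition discrete_set :: "'g::topological_space set \<Rightarrow> bool" where
  "discrete_set \<Gamma> \<longleftrightarrow> (\<forall>x\<in>\<Gamma>. \<exists>U. open U \<and> U \<inter> \<Gamma> = {x})"

text \<open>Cocompact: G/Gamma compact, i.e. G = K Gamma for a compact K.\<close>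
definition cocompact :: "('g::topological_space \<Rightarrow> 'g \<Rightarrow> 'g) \<Rightarrow> 'g set \<Rightarrow> bool" where
  "cocompact gmult \<Gamma> \<longleftrightarrow> (\<exists>K. compact K \<and> (\<forall>g. \<exists>k\<in>K. \<exists>\<gamma>\<in>\<Gamma>. g = gmult k \<gamma>))"

definition is_lattice_in :: "('g::topological_space \<Rightarrow> 'g \<Rightarrow> 'g) \<Rightarrow> 'g \<Rightarrow> 'g set \<Rightarrow> bool" where
  "is_lattice_in gmult e \<Gamma> \<longleftrightarrow> is_subgroup gmult e \<Gamma> \<and> discrete_set \<Gamma> \<and> cocompact gmult \<Gamma>"

definition admits_lattice :: "('g::topological_space \<Rightarrow> 'g \<Rightarrow> 'g) \<Rightarrow> 'g \<Rightarrow> bool" where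
  "admits_lattice gmult e \<longleftrightarrow> (\<exists>\<Gamma>. is_lattice_in gmult e \<Gamma>)"

text \<open>A lattice of (R^2)^* (discrete subgroup of rank 2) = Z-span of a basis.\<close>
definition plane_lattice :: "(real^2) set \<Rightarrow> bool" where
  "plane_lattice \<Lambda> \<longleftrightarrow> (\<exists>u v. independent {u, v} \<and> u \<noteq> v \<and>
      \<Lambda> = {of_int m *\<^sub>R u + of_int n *\<^sub>R v | m n. True})"

definition in_two_lines :: "('q \<Rightarrow> real^2) \<Rightarrow> bool" where
  "in_two_lines \<mu> \<longleftrightarrow> (\<exists>u v. u \<noteq> 0 \<and> v \<noteq> 0 \<and> range \<mu> \<subseteq> span {u} \<union> span {v})"

end

theory Submission
  imports Defs
begin

text \<open>
  Suppose the weights lie in \<open>\<Lambda> = \<int>u + \<int>v\<close>. The elements \<open>t\<close> of the lattice \<open>L\<close> in \<open>l\<close> that is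
  \<open>2\<pi>\<close> times the dual of \<open>\<Lambda>\<close> act trivially on \<open>a\<close>, so suitably scaled Gaussian integers in \<open>a\<close>
  and a multiple of \<open>\<Lambda>\<close> in \<open>z\<close> complete \<open>L\<close> to a lattice.

  Conversely, let \<open>\<Gamma>\<close> be a lattice and call \<open>\<gamma> \<in> \<Gamma>\<close> over \<open>t\<close> small if every
  \<open>\<chi>\<^sub>j = exp (i \<mu>\<^sub>j(t))\<close> is within distance less than 1 of 1. Iterating \<open>\<delta> \<mapsto> [\<gamma>, \<delta>]\<close> on elements
  \<open>\<delta> \<in> \<Gamma>\<close> over \<open>t = 0\<close> converges to the identity, so by discreteness \<open>exp (\<rho>(t))\<close> fixes their
  \<open>a\<close>-components. Applied to \<open>\<delta> = [\<gamma>, \<gamma>']\<close>, this determines \<open>a'\<^sub>j\<close> as a bounded function of \<open>\<gamma>'\<close>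
  whenever \<open>\<chi>\<^sub>j \<noteq> 1\<close>, contradicting cocompactness; hence \<open>\<mu>\<^sub>j(t) \<in> 2\<pi>\<int>\<close> for all \<open>j\<close>. By Dirichlet
  every element has a small power, and cocompactness provides two elements over linearly independent
  \<open>t\<close>, so all \<open>\<mu>\<^sub>j\<close> lie in \<open>2\<pi>\<close> times a dual lattice.
\<close>

section \<open>Discrete and cobounded sets\<close>

text \<open>A common gap for all points passes to products by taking the smaller of two gaps, so
  lattices can be assembled from their factors before weakening to
  \<open>discrete_set\<close>.\<close>

definition uniformly_discrete :: "'a::metric_space set \<Rightarrow> bool" where
  "uniformly_discrete S \<longleftrightarrow> (\<exists>e>0. \<forall>x\<in>S. \<forall>y\<in>S. dist x y < e \<longrightarrow> x = y)"

lemma uniformly_discrete_imp_discrete_set: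
  assumes "uniformly_discrete S"
  shows "discrete_set S"
proof -
  obtain e where "e > 0" and e: "\<And>x y. x \<in> S \<Longrightarrow> y \<in> S \<Longrightarrow> dist x y < e \<Longrightarrow> x = y"
    using assms unfolding uniformly_discrete_def by blast
  then have "open (ball x e) \<and> ball x e \<inter> S = {x}" if "x \<in> S" for x
    using that \<open>e > 0\<close> e by (auto, metis)
  then show ?thesis
    unfolding discrete_set_def by blast
qed

lemma uniformly_discrete_Times:
  assumes "uniformly_discrete A" "uniformly_discrete B"
  shows "uniformly_discrete (A \<times> B)"
proof -
  obtain e f where "e > 0" and e: "\<And>x y. x \<in> A \<Longrightarrow> y \<in> A \<Longrightarrow> dist x y < e \<Longrightarrow> x = y"
    and "f > 0" and f: "\<And>x y. x \<in> B \<Longrightarrow> y \<in> B \<Longrightarrow> dist x y < f \<Longrightarrow> x = y"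
    using assms unfolding uniformly_discrete_def by meson
  have "x = y" if "x \<in> A \<times> B" "y \<in> A \<times> B" "dist x y < min e f" for x y
    using that e[of "fst x" "fst y"] f[of "snd x" "snd y"] dist_fst_le[of x y] dist_snd_le[of x y]
    by (auto simp: prod_eq_iff mem_Times_iff)
  then show ?thesis
    unfolding uniformly_discrete_def using \<open>e > 0\<close> \<open>f > 0\<close> by (intro exI[of _ "min e f"]) auto
qed

text \<open>In finite dimension the closed balls of radius \<open>B\<close> supply the compact set
  that \<open>cocompact\<close> asks for.\<close>

definition cobounded :: "'a::real_normed_vector set \<Rightarrow> bool" where
  "cobounded S \<longleftrightarrow> (\<exists>B. \<forall>x. \<exists>y\<in>S. norm (x - y) \<le> B)"

lemma coboundedE:
  assumes "cobounded S"
  obtains B where "\<And>x. \<exists>y\<in>S. norm (x - y) \<le> B"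
  using assms unfolding cobounded_def by blast

definition int_multiples :: "real \<Rightarrow> real set" where
  "int_multiples c = range (\<lambda>n. c * of_int n)"

lemma int_multiples_iff: "x \<in> int_multiples c \<longleftrightarrow> (\<exists>n. x = c * of_int n)"
  by (auto simp: int_multiples_def)

lemma uniformly_discrete_int_multiples:
  assumes "c > 0"
  shows "uniformly_discrete (int_multiples c)"
proof -
  have "m = n" if "dist (c * real_of_int m) (c * of_int n) < c" for m n
  proof -
    have "c * \<bar>real_of_int (m - n)\<bar> < c * 1"
      using that assms by (simp add: dist_real_def abs_mult flip: right_diff_distrib)
    then have "\<bar>real_of_int (m - n)\<bar> < 1"
      using assms by simp
    then show ?thesis by linarith
  qed
  then show ?thesis
    unfolding uniformly_discrete_def int_multiples_def using assms by (intro exI[of _ c]) blast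
qed

lemma int_multiples_near:
  assumes "c > 0"
  shows "\<exists>y\<in>int_multiples c. \<bar>x - y\<bar> \<le> c"
proof -
  have "c * (x / c - of_int \<lfloor>x / c\<rfloor>) \<le> c * 1" "c * (x / c - of_int \<lfloor>x / c\<rfloor>) \<ge> 0"
    using assms by (intro mult_left_mono mult_nonneg_nonneg; linarith)+
  then have "\<bar>x - c * of_int \<lfloor>x / c\<rfloor>\<bar> \<le> c"
    using assms by (simp add: right_diff_distrib)
  then show ?thesis
    unfolding int_multiples_def by blast
qed

text \<open>The scale used later is a multiple of \<open>1 / d\<close>, whose sign depends on the
  orientation of the basis, whereas the discreteness and covering facts are for positive
  scales.\<close>

lemma int_multiples_abs: "int_multiples \<bar>c\<bar> = int_multiples c"
proof -
  have "int_multiples (- c) \<subseteq> int_multiples c" for c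
    by (auto simp: int_multiples_iff) (metis mult_minus_right of_int_minus)
  from this[of c] this[of "- c"] show ?thesis
    by (auto simp: abs_if)
qed

lemma cobounded_int_multiples: "c > 0 \<Longrightarrow> cobounded (int_multiples c)"
  unfolding cobounded_def using int_multiples_near by fastforce

section \<open>Plane lattices\<close>

lemma alpha_simps:
  "alpha (x + y) w = alpha x w + alpha y w" "alpha w (x + y) = alpha w x + alpha w y"
  "alpha (c *\<^sub>R x) w = c * alpha x w" "alpha w (c *\<^sub>R x) = c * alpha w x"
  "alpha x x = 0" "alpha 0 x = 0" "alpha x 0 = 0"
  "alpha (- x) w = - alpha x w" "alpha w (- x) = - alpha w x"
  by (simp_all add: alpha_def algebra_simps)

lemma bounded_bilinear_alpha: "bounded_bilinear alpha"
  unfolding bilinear_conv_bounded_bilinear[symmetric] bilinear_def alpha_def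
  by (auto intro!: linearI simp: algebra_simps)

text \<open>\<open>alpha\<close> is the 2 x 2 determinant. If it vanishes, each coordinate of
  \<open>v\<close> gives a proportionality between \<open>u\<close> and \<open>v\<close>; a nonzero
  coordinate allows division.\<close>

lemma independent_pair_iff_alpha:
  "independent {u, v} \<and> u \<noteq> v \<longleftrightarrow> alpha u v \<noteq> 0"
proof
  assume *: "independent {u, v} \<and> u \<noteq> v"
  show "alpha u v \<noteq> 0"
  proof
    assume "alpha u v = 0"
    then have "v $ 1 *\<^sub>R u = u $ 1 *\<^sub>R v" "v $ 2 *\<^sub>R u = u $ 2 *\<^sub>R v"
      by (auto simp: alpha_def vec_eq_iff forall_2 algebra_simps)
    moreover obtain k where "v $ k \<noteq> 0"
      using * dependent_zero[of "{u, v}"] by (metis insertCI vec_eq_iff zero_index)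
    ultimately obtain k where "v $ k *\<^sub>R u = u $ k *\<^sub>R v" "v $ k \<noteq> 0"
      by (metis exhaust_2)
    then have "u = (u $ k / v $ k) *\<^sub>R v"
      by (metis divide_inverse_commute scaleR_scaleR vector_fraction_eq_iff)
    then have "u \<in> span {v}"
      by (metis insertI1 span_base span_scale)
    then show False
      using * by (simp add: independent_insert)
  qed
next
  assume *: "alpha u v \<noteq> 0"
  have "u \<noteq> k *\<^sub>R v" for k
    using * by (auto simp: alpha_simps)
  moreover have "v \<noteq> 0"
    using * by (auto simp: alpha_simps)
  ultimately show "independent {u, v} \<and> u \<noteq> v"
    by (auto simp: independent_insert span_singleton) (metis scaleR_one)
qed

text \<open>The set from \<open>plane_lattice\<close> with independence split off; the latter is
  tracked as \<open>alpha u v \<noteq> 0\<close>.\<close>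

definition int_span :: "real^2 \<Rightarrow> real^2 \<Rightarrow> (real^2) set" where
  "int_span u v = {of_int m *\<^sub>R u + of_int n *\<^sub>R v | m n. True}"

lemma plane_lattice_iff: "plane_lattice \<Lambda> \<longleftrightarrow> (\<exists>u v. alpha u v \<noteq> 0 \<and> \<Lambda> = int_span u v)"
  unfolding plane_lattice_def int_span_def using independent_pair_iff_alpha by blast

lemma int_span_iff: "x \<in> int_span u v \<longleftrightarrow> (\<exists>m n. x = of_int m *\<^sub>R u + of_int n *\<^sub>R v)"
  by (auto simp: int_span_def)

lemma int_span_0: "0 \<in> int_span u v"
  unfolding int_span_iff by (rule exI[of _ 0], rule exI[of _ 0]) simp

lemma int_span_add:
  assumes "x \<in> int_span u v" "y \<in> int_span u v"
  shows "x + y \<in> int_span u v"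
proof -
  obtain m n m' n' where "x = of_int m *\<^sub>R u + of_int n *\<^sub>R v" "y = of_int m' *\<^sub>R u + of_int n' *\<^sub>R v"
    using assms unfolding int_span_iff by blast
  then have "x + y = of_int (m + m') *\<^sub>R u + of_int (n + n') *\<^sub>R v"
    by (simp add: algebra_simps)
  then show ?thesis unfolding int_span_iff by blast
qed

lemma int_span_scale:
  assumes "x \<in> int_span u v"
  shows "of_int k *\<^sub>R x \<in> int_span u v"
proof -
  obtain m n where "x = of_int m *\<^sub>R u + of_int n *\<^sub>R v"
    using assms unfolding int_span_iff by blast
  then have "of_int k *\<^sub>R x = of_int (k * m) *\<^sub>R u + of_int (k * n) *\<^sub>R v"
    by (simp add: algebra_simps)
  then show ?thesis unfolding int_span_iff by blast
qed

lemma int_span_minus: "x \<in> int_span u v \<Longrightarrow> - x \<in> int_span u v"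
  using int_span_scale[of x u v "-1"] by simp

lemma int_span_diff: "x \<in> int_span u v \<Longrightarrow> y \<in> int_span u v \<Longrightarrow> x - y \<in> int_span u v"
  using int_span_add[of x u v "- y"] int_span_minus[of y u v] by simp

lemma int_span_sum: "(\<And>i. i \<in> I \<Longrightarrow> f i \<in> int_span u v) \<Longrightarrow> sum f I \<in> int_span u v"
  by (induction I rule: infinite_finite_induct) (auto intro: int_span_0 int_span_add)

lemma int_span_basis: "u \<in> int_span u v" "v \<in> int_span u v"
  unfolding int_span_iff
  by (rule exI[of _ 1], rule exI[of _ 0], simp) (rule exI[of _ 0], rule exI[of _ 1], simp)

lemma int_span_scaled_basis:
  "x \<in> int_span u v \<Longrightarrow> c *\<^sub>R x \<in> int_span (c *\<^sub>R u) (c *\<^sub>R v)"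
  unfolding int_span_iff by (force simp: algebra_simps)

text \<open>Cramer's rule: as \<open>alpha\<close> is alternating, pairing with \<open>v\<close> and
  with \<open>u\<close> isolates one coefficient each.\<close>

lemma plane_expansion:
  assumes "alpha u v \<noteq> 0"
  shows "x = (alpha x v / alpha u v) *\<^sub>R u + (alpha u x / alpha u v) *\<^sub>R v"
proof -
  have "alpha u v *\<^sub>R x = alpha x v *\<^sub>R u + alpha u x *\<^sub>R v"
    by (simp add: vec_eq_iff forall_2 alpha_def algebra_simps)
  then have "x = (1 / alpha u v) *\<^sub>R (alpha x v *\<^sub>R u + alpha u x *\<^sub>R v)"
    using assms by (metis divide_self_if inverse_eq_divide scaleR_one scaleR_scaleR left_inverse)
  then show ?thesis by (simp add: scaleR_add_right)
qed

text \<open>The functionals \<open>alpha x v\<close> and \<open>alpha u x\<close> are bounded and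
  take values in the integer multiples of \<open>alpha u v\<close> on the span, so a short
  difference of lattice points has both coefficients zero.\<close>

lemma uniformly_discrete_int_span:
  assumes "alpha u v \<noteq> 0"
  shows "uniformly_discrete (int_span u v)"
proof -
  interpret bounded_bilinear alpha by (rule bounded_bilinear_alpha)
  obtain K where "K > 0" and K: "\<And>x y. \<bar>alpha x y\<bar> \<le> norm x * norm y * K"
    using pos_bounded by auto
  \<comment> \<open>One constant serves both functionals; the summand 1 makes it visibly
    positive.\<close>
  define M where "M = K * (norm u + norm v + 1)"
  have "M > 0"
    using \<open>K > 0\<close> by (simp add: M_def add_nonneg_pos)
  have M: "\<bar>alpha x v\<bar> \<le> norm x * M" "\<bar>alpha u x\<bar> \<le> norm x * M" for x
  proof -
    have "norm x * norm w * K \<le> norm x * M" if "norm w \<le> norm u + norm v + 1" for w :: "real^2"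
      using that \<open>K > 0\<close> by (simp add: M_def mult.assoc mult.commute[of _ K] mult_left_mono)
    from this[of v] this[of u] K[of x v] K[of u x]
    show "\<bar>alpha x v\<bar> \<le> norm x * M" "\<bar>alpha u x\<bar> \<le> norm x * M"
      by (simp_all add: mult.commute[of "norm x" "norm u"])
  qed
  have zero: "k = 0" if "\<bar>of_int k * alpha u v\<bar> < \<bar>alpha u v\<bar>" for k
  proof -
    have "\<bar>real_of_int k\<bar> * \<bar>alpha u v\<bar> < 1 * \<bar>alpha u v\<bar>"
      using that by (simp add: abs_mult)
    then have "\<bar>real_of_int k\<bar> < 1"
      by (rule mult_right_less_imp_less) simp
    then show ?thesis by linarith
  qed
  have "x = y" if xy: "x \<in> int_span u v" "y \<in> int_span u v" "dist x y < \<bar>alpha u v\<bar> / M" for x y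
  proof -
    obtain m n where mn: "x - y = of_int m *\<^sub>R u + of_int n *\<^sub>R v"
      using int_span_diff[OF xy(1,2)] unfolding int_span_iff by blast
    have "norm (x - y) * M < \<bar>alpha u v\<bar>"
      using xy(3) \<open>M > 0\<close> by (simp add: dist_norm pos_less_divide_eq)
    then have "m = 0" "n = 0"
      using M(1)[of "x - y"] M(2)[of "x - y"] unfolding mn
      by (auto intro!: zero simp: alpha_simps)
    with mn show ?thesis by simp
  qed
  then show ?thesis
    unfolding uniformly_discrete_def using \<open>M > 0\<close> assms
    by (intro exI[of _ "\<bar>alpha u v\<bar> / M"]) auto
qed

text \<open>Rounding down both coordinates leaves a point of the fundamental parallelogram.\<close>

lemma cobounded_int_span:
  assumes "alpha u v \<noteq> 0"
  shows "cobounded (int_span u v)"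
proof -
  have "\<exists>y\<in>int_span u v. norm (x - y) \<le> norm u + norm v" for x
  proof -
    define p q where "p = alpha x v / alpha u v" and "q = alpha u x / alpha u v"
    have "x - (of_int \<lfloor>p\<rfloor> *\<^sub>R u + of_int \<lfloor>q\<rfloor> *\<^sub>R v) = (p - of_int \<lfloor>p\<rfloor>) *\<^sub>R u + (q - of_int \<lfloor>q\<rfloor>) *\<^sub>R v"
      using plane_expansion[OF assms, of x] by (simp add: p_def q_def algebra_simps)
    moreover have "norm ((p - of_int \<lfloor>p\<rfloor>) *\<^sub>R u) \<le> norm u" "norm ((q - of_int \<lfloor>q\<rfloor>) *\<^sub>R v) \<le> norm v"
      by (auto intro!: mult_left_le_one_le; linarith)+
    ultimately have "norm (x - (of_int \<lfloor>p\<rfloor> *\<^sub>R u + of_int \<lfloor>q\<rfloor> *\<^sub>R v)) \<le> norm u + norm v"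
      by (metis norm_triangle_mono)
    then show ?thesis
      unfolding int_span_def by blast
  qed
  then show ?thesis unfolding cobounded_def by blast
qed

section \<open>The rotation action and the form omega\<close>

text \<open>In each coordinate the real part of \<open>\<i> * a * cnj a'\<close> is the standard
  area form, so \<open>omega\<close> is a sum of area forms weighted by the
  \<open>\<mu> j\<close>.\<close>

lemma omega_eq_sum:
  "omega \<mu> a a' = (\<Sum>j\<in>UNIV. (Re (a $ j) * Im (a' $ j) - Im (a $ j) * Re (a' $ j)) *\<^sub>R \<mu> j)"
  by (simp add: vec_eq_iff omega_def rho_def pair_l_def inner_vec_def[of "vec_lambda _"] inner_axis
      inner_complex_def algebra_simps sum_subtractf)

lemma omega_simps:
  "omega \<mu> (a + b) c = omega \<mu> a c + omega \<mu> b c"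
  "omega \<mu> c (a + b) = omega \<mu> c a + omega \<mu> c b"
  "omega \<mu> (- a) c = - omega \<mu> a c" "omega \<mu> c (- a) = - omega \<mu> c a"
  "omega \<mu> (a - b) c = omega \<mu> a c - omega \<mu> b c"
  "omega \<mu> c (a - b) = omega \<mu> c a - omega \<mu> c b"
  "omega \<mu> a a = 0" "omega \<mu> 0 a = 0" "omega \<mu> a 0 = 0"
  by (simp_all add: omega_eq_sum algebra_simps sum.distrib sum_subtractf sum_negf)

lemma omega_swap: "omega \<mu> a b = - omega \<mu> b a"
  by (simp add: omega_eq_sum algebra_simps flip: sum_negf)

lemma rot_nth: "rot \<mu> t a $ j = exp (\<i> * complex_of_real (\<mu> j \<bullet> t)) * a $ j"
  by (simp add: rot_def pair_l_def)

lemma rot_simps: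
  "rot \<mu> 0 a = a" "rot \<mu> t 0 = 0" "rot \<mu> s (rot \<mu> t a) = rot \<mu> (s + t) a"
  "rot \<mu> t (a + b) = rot \<mu> t a + rot \<mu> t b" "rot \<mu> t (- a) = - rot \<mu> t a"
  "rot \<mu> t (a - b) = rot \<mu> t a - rot \<mu> t b"
  by (simp_all add: vec_eq_iff rot_nth algebra_simps exp_add)

lemma norm_rot [simp]: "norm (rot \<mu> t a) = norm a"
  by (simp add: norm_vec_def rot_nth norm_mult)

lemma exp_int_mult_2pi: "exp (\<i> * complex_of_real (of_int n * (2 * pi))) = 1"
  unfolding exp_eq_1 by auto

section \<open>Lattices from weights in a plane lattice\<close>

text \<open>The lattice \<open>c\<close> Z[i]^q. Scale 1 serves the oscillator group; for
  \<open>D_q\<close> the scale is fitted to the central part of the lattice.\<close>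

definition gauss_lattice :: "real \<Rightarrow> (complex^'q) set" where
  "gauss_lattice c = {a. \<forall>j. Re (a $ j) \<in> int_multiples c \<and> Im (a $ j) \<in> int_multiples c}"

lemma gauss_lattice_0: "0 \<in> gauss_lattice c"
  by (auto simp: gauss_lattice_def int_multiples_iff intro: exI[of _ 0])

lemma int_multiples_add: "x \<in> int_multiples c \<Longrightarrow> y \<in> int_multiples c \<Longrightarrow> x + y \<in> int_multiples c"
  by (auto simp: int_multiples_iff) (metis distrib_left of_int_add)

lemma int_multiples_minus: "x \<in> int_multiples c \<Longrightarrow> - x \<in> int_multiples c"
  by (auto simp: int_multiples_iff) (metis mult_minus_right of_int_minus)

lemma gauss_lattice_add: "a \<in> gauss_lattice c \<Longrightarrow> b \<in> gauss_lattice c \<Longrightarrow> a + b \<in> gauss_lattice c"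
  by (simp add: gauss_lattice_def int_multiples_add)

lemma gauss_lattice_minus: "a \<in> gauss_lattice c \<Longrightarrow> - a \<in> gauss_lattice c"
  by (simp add: gauss_lattice_def int_multiples_minus)

lemma uniformly_discrete_gauss_lattice:
  assumes "c > 0"
  shows "uniformly_discrete (gauss_lattice c :: (complex^'q::finite) set)"
proof -
  obtain e where "e > 0"
    and e: "\<And>x y. x \<in> int_multiples c \<Longrightarrow> y \<in> int_multiples c \<Longrightarrow> dist x y < e \<Longrightarrow> x = y"
    using uniformly_discrete_int_multiples[OF assms] unfolding uniformly_discrete_def by blast
  have "a = b" if ab: "a \<in> gauss_lattice c" "b \<in> gauss_lattice c" "dist a b < e" for a b :: "complex^'q"
  proof -
    have "a $ j = b $ j" for j
    proof (rule complex_eqI)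
      have "cmod (a $ j - b $ j) < e"
        using ab(3) Finite_Cartesian_Product.norm_nth_le[of "a - b" j] by (simp add: dist_norm)
      then have "\<bar>Re (a $ j) - Re (b $ j)\<bar> < e" "\<bar>Im (a $ j) - Im (b $ j)\<bar> < e"
        using abs_Re_le_cmod[of "a $ j - b $ j"] abs_Im_le_cmod[of "a $ j - b $ j"] by auto
      then show "Re (a $ j) = Re (b $ j)" "Im (a $ j) = Im (b $ j)"
        using ab(1,2) by (auto intro!: e simp: gauss_lattice_def dist_real_def)
    qed
    then show ?thesis by (simp add: vec_eq_iff)
  qed
  then show ?thesis
    unfolding uniformly_discrete_def using \<open>e > 0\<close> by blast
qed

lemma cobounded_gauss_lattice:
  assumes "c > 0"
  shows "cobounded (gauss_lattice c :: (complex^'q::finite) set)"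
proof -
  have "\<exists>b\<in>gauss_lattice c. norm (a - b) \<le> of_nat CARD('q) * (2 * c)" for a :: "complex^'q"
  proof -
    obtain r where r: "\<And>x. r x \<in> int_multiples c" "\<And>x. \<bar>x - r x\<bar> \<le> c"
      using int_multiples_near[OF assms] by metis
    define b :: "complex^'q" where "b = (\<chi> j. Complex (r (Re (a $ j))) (r (Im (a $ j))))"
    have "cmod ((a - b) $ j) \<le> 2 * c" for j
      using cmod_le[of "(a - b) $ j"] r(2)[of "Re (a $ j)"] r(2)[of "Im (a $ j)"]
      by (simp add: b_def)
    then have "norm (a - b) \<le> of_nat CARD('q) * (2 * c)"
      using sum_bounded_above[of UNIV "\<lambda>j. cmod ((a - b) $ j)" "2 * c"]
        L2_set_le_sum[of UNIV "\<lambda>j. cmod ((a - b) $ j)"]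
      by (simp add: norm_vec_def)
    moreover have "b \<in> gauss_lattice c"
      by (simp add: gauss_lattice_def b_def r)
    ultimately show ?thesis by blast
  qed
  then show ?thesis unfolding cobounded_def by blast
qed

text \<open>The area form takes values in \<open>c\<^sup>2\<close> Z on \<open>c\<close> Z[i], and
  the weights it multiplies lie in the span of \<open>u\<close> and \<open>v\<close>.\<close>

lemma omega_gauss_lattice:
  assumes "range \<mu> \<subseteq> int_span u v" "a \<in> gauss_lattice c" "b \<in> gauss_lattice c"
  shows "omega \<mu> a b \<in> int_span (c\<^sup>2 *\<^sub>R u) (c\<^sup>2 *\<^sub>R v)"
  unfolding omega_eq_sum
proof (rule int_span_sum)
  fix j
  obtain k l m n where "Re (a $ j) = c * of_int k" "Im (a $ j) = c * of_int l"
    "Re (b $ j) = c * of_int m" "Im (b $ j) = c * of_int n"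
    using assms(2,3) by (force simp: gauss_lattice_def int_multiples_iff)
  then have "(Re (a $ j) * Im (b $ j) - Im (a $ j) * Re (b $ j)) *\<^sub>R \<mu> j
      = c\<^sup>2 *\<^sub>R of_int (k * n - l * m) *\<^sub>R \<mu> j"
    by (simp add: algebra_simps power2_eq_square)
  moreover have "\<mu> j \<in> int_span u v"
    using assms(1) by blast
  ultimately show "(Re (a $ j) * Im (b $ j) - Im (a $ j) * Re (b $ j)) *\<^sub>R \<mu> j
      \<in> int_span (c\<^sup>2 *\<^sub>R u) (c\<^sup>2 *\<^sub>R v)"
    by (metis int_span_scale int_span_scaled_basis)
qed

section \<open>The lattice in \<open>l\<close> dual to a lattice of weights\<close>

locale plane_basis =
  fixes u v :: "real^2"
  assumes alpha_uv: "alpha u v \<noteq> 0"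
begin

definition d where "d = alpha u v"

text \<open>\<open>2\<pi>\<close> times the dual basis of \<open>u, v\<close>\<close>

definition e1 :: "real^2" where "e1 = (2 * pi / d) *\<^sub>R vector [v $ 2, - v $ 1]"
definition e2 :: "real^2" where "e2 = (2 * pi / d) *\<^sub>R vector [- u $ 2, u $ 1]"
definition L where "L = int_span e1 e2"

lemma d_nz: "d \<noteq> 0"
  using alpha_uv by (simp add: d_def)

lemma inner_dual_basis:
  "u \<bullet> e1 = 2 * pi" "u \<bullet> e2 = 0" "v \<bullet> e1 = 0" "v \<bullet> e2 = 2 * pi"
proof -
  have "u \<bullet> e1 = (2 * pi / d) * alpha u v" "v \<bullet> e2 = (2 * pi / d) * alpha u v"
    by (simp_all add: e1_def e2_def inner_vec_def sum_2 alpha_def diff_divide_distrib algebra_simps)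
  then show "u \<bullet> e1 = 2 * pi" "v \<bullet> e2 = 2 * pi"
    using d_nz by (simp_all add: d_def)
  show "u \<bullet> e2 = 0" "v \<bullet> e1 = 0"
    by (simp_all add: e1_def e2_def inner_vec_def sum_2)
qed

text \<open>Up to order and sign the dual vectors are \<open>u, v\<close> turned by a right angle
  and scaled by \<open>2 * pi / d\<close>, so the determinant \<open>d\<close> is multiplied by the
  square of that factor.\<close>

lemma alpha_dual_basis: "alpha e1 e2 = (2 * pi)\<^sup>2 / d"
proof -
  have "alpha e1 e2 = (2 * pi / d)\<^sup>2 * (v $ 2 * u $ 1 - v $ 1 * u $ 2)"
    by (simp add: e1_def e2_def alpha_def power2_eq_square diff_divide_distrib algebra_simps)
  also have "\<dots> = (2 * pi / d)\<^sup>2 * d"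
    by (simp add: d_def alpha_def mult.commute)
  also have "\<dots> = (2 * pi)\<^sup>2 / d"
    using d_nz by (simp add: power2_eq_square)
  finally show ?thesis .
qed

lemma alpha_dual_basis_nz: "alpha e1 e2 \<noteq> 0"
  using d_nz by (simp add: alpha_dual_basis)

text \<open>Weights pair with \<open>L\<close> in 2 pi Z; over \<open>L\<close> the semidirect twist
  therefore disappears.\<close>

lemma rot_L:
  assumes "range \<mu> \<subseteq> int_span u v" "t \<in> L"
  shows "rot \<mu> t a = a"
proof -
  have "exp (\<i> * complex_of_real (\<mu> j \<bullet> t)) = 1" for j
  proof -
    obtain m n where m: "\<mu> j = of_int m *\<^sub>R u + of_int n *\<^sub>R v"
      using assms(1) unfolding int_span_def by blast
    obtain k l where t: "t = of_int k *\<^sub>R e1 + of_int l *\<^sub>R e2"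
      using assms(2) unfolding L_def int_span_iff by blast
    have "\<mu> j \<bullet> t = of_int (m * k + n * l) * (2 * pi)"
      unfolding m t by (simp add: inner_add_left inner_add_right inner_dual_basis algebra_simps)
    then show ?thesis
      using exp_int_mult_2pi by metis
  qed
  then show ?thesis
    by (simp add: vec_eq_iff rot_nth)
qed

end

section \<open>A lattice in the oscillator group\<close>

lemma osc_lattice:
  assumes "range \<mu> \<subseteq> int_span u v" "alpha u v \<noteq> 0"
  shows "admits_lattice (osc_mult \<mu>) osc_one"
proof -
  interpret plane_basis u v
    by unfold_locales fact
  \<comment> \<open>The factor 1/2 in front of \<open>omega\<close> in the group law forces half of
    the weight lattice in \<open>z\<close>.\<close>
  define Z where "Z = int_span ((1/2) *\<^sub>R u) ((1/2) *\<^sub>R v)"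
  define A where "A = (gauss_lattice 1 :: (complex^'a) set)"
  define \<Gamma> where "\<Gamma> = Z \<times> A \<times> L"
  have half: "(1/2) *\<^sub>R omega \<mu> a b \<in> Z" if "a \<in> A" "b \<in> A" for a b
    using omega_gauss_lattice[OF assms(1), of a 1 b] that
    by (auto simp: A_def Z_def intro: int_span_scaled_basis)
  have nz: "alpha ((1/2) *\<^sub>R u) ((1/2) *\<^sub>R v) \<noteq> 0"
    using assms(2) by (simp add: alpha_simps)
  have "osc_mult \<mu> x y \<in> \<Gamma>" if \<Gamma>: "x \<in> \<Gamma>" "y \<in> \<Gamma>" for x y
  proof -
    obtain z a t z' a' t' where xy: "x = (z, a, t)" "y = (z', a', t')"
      "z \<in> Z" "a \<in> A" "t \<in> L" "z' \<in> Z" "a' \<in> A" "t' \<in> L"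
      using \<Gamma> by (auto simp: \<Gamma>_def)
    have "osc_mult \<mu> x y = (z + z' + (1/2) *\<^sub>R omega \<mu> a a', a + a', t + t')"
      using xy assms(1) by (simp add: osc_mult_def rot_L)
    moreover have "z + z' + (1/2) *\<^sub>R omega \<mu> a a' \<in> Z" "a + a' \<in> A" "t + t' \<in> L"
      using xy half by (simp_all add: Z_def A_def L_def int_span_add gauss_lattice_add)
    ultimately show ?thesis by (simp add: \<Gamma>_def)
  qed
  moreover have "\<exists>y\<in>\<Gamma>. osc_mult \<mu> x y = osc_one" if \<Gamma>: "x \<in> \<Gamma>" for x
  proof -
    obtain z a t where x: "x = (z, a, t)" "z \<in> Z" "a \<in> A" "t \<in> L"
      using \<Gamma> by (auto simp: \<Gamma>_def)
    have "osc_mult \<mu> x (- z, - a, - t) = osc_one"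
      using x assms(1) by (simp add: osc_mult_def osc_one_def rot_L omega_simps)
    moreover have "(- z, - a, - t) \<in> \<Gamma>"
      using x by (auto simp: \<Gamma>_def Z_def A_def L_def int_span_minus gauss_lattice_minus)
    ultimately show ?thesis by blast
  qed
  moreover have "osc_one \<in> \<Gamma>"
    by (simp add: osc_one_def \<Gamma>_def Z_def A_def L_def int_span_0 gauss_lattice_0)
  ultimately have "is_subgroup (osc_mult \<mu>) osc_one \<Gamma>"
    unfolding is_subgroup_def by blast
  moreover have "discrete_set \<Gamma>"
    unfolding \<Gamma>_def Z_def A_def L_def
    by (intro uniformly_discrete_imp_discrete_set uniformly_discrete_Times uniformly_discrete_int_span
        uniformly_discrete_gauss_lattice nz alpha_dual_basis_nz) simp
  moreover have "cocompact (osc_mult \<mu>) \<Gamma>"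
  proof -
    obtain B1 where B1: "\<And>x. \<exists>y\<in>Z. norm (x - y) \<le> B1"
      using coboundedE[OF cobounded_int_span[OF nz]] unfolding Z_def by metis
    obtain B2 where B2: "\<And>x. \<exists>y\<in>A. norm (x - y) \<le> B2"
      using coboundedE[OF cobounded_gauss_lattice[of 1, where 'q='a]] unfolding A_def by (metis zero_less_one)
    obtain B3 where B3: "\<And>x. \<exists>y\<in>L. norm (x - y) \<le> B3"
      using coboundedE[OF cobounded_int_span[OF alpha_dual_basis_nz]] unfolding L_def by metis
    define K where "K = (cball 0 B1 \<times> cball 0 B2 \<times> cball 0 B3 :: ((real^2) \<times> (complex^'a) \<times> (real^2)) set)"
    have "\<exists>k\<in>K. \<exists>\<gamma>\<in>\<Gamma>. g = osc_mult \<mu> k \<gamma>" for g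
    proof -
      obtain z a t where g: "g = (z, a, t)" by (cases g)
      \<comment> \<open>The factorisation is solved in the order \<open>t\<close>, \<open>a\<close>,
        \<open>z\<close>: each correction term involves only components already chosen.\<close>
      obtain t' where t': "t' \<in> L" "norm (t - t') \<le> B3" using B3 by blast
      \<comment> \<open>In the product \<open>a'\<close> appears rotated by \<open>t - t'\<close>,
        so rounding is applied to \<open>a\<close> rotated back; rotations are isometries and keep
        the bound.\<close>
      obtain a' where a': "a' \<in> A" "norm (rot \<mu> (- (t - t')) a - a') \<le> B2" using B2 by blast
      define b where "b = a - rot \<mu> (t - t') a'"
      have "b = rot \<mu> (t - t') (rot \<mu> (- (t - t')) a - a')"
        unfolding b_def rot_simps(6) rot_simps(3) by (simp add: rot_simps)
      then have b: "norm b \<le> B2"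
        using a'(2) by simp
      define w where "w = (1/2) *\<^sub>R omega \<mu> b (rot \<mu> (t - t') a')"
      obtain z' where z': "z' \<in> Z" "norm (z - w - z') \<le> B1" using B1 by blast
      have "g = osc_mult \<mu> (z - w - z', b, t - t') (z', a', t')"
        by (simp add: osc_mult_def g w_def) (simp add: b_def)
      moreover have "(z - w - z', b, t - t') \<in> K"
        using z' b t' by (simp add: K_def)
      moreover have "(z', a', t') \<in> \<Gamma>"
        using z' a' t' by (simp add: \<Gamma>_def)
      ultimately show ?thesis by blast
    qed
    moreover have "compact K"
      unfolding K_def by (intro compact_Times compact_cball)
    ultimately show ?thesis
      unfolding cocompact_def by blast
  qed
  ultimately show ?thesis
    unfolding admits_lattice_def is_lattice_in_def by blast
qed

section \<open>The nilpotent group \<open>D_0\<close> and its lattice\<close>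

lemma flat_simps:
  "flat (x + y) = flat x + flat y" "flat (c *\<^sub>R x) = c *\<^sub>R flat x" "flat 0 = 0"
  "flat (- x) = - flat x"
  by (simp_all add: flat_def vec_eq_iff alpha_simps)

lemma flat_eq: "flat t = vector [- t $ 2, t $ 1]"
  by (simp add: flat_def vec_eq_iff alpha_def forall_2 axis_def)

text \<open>The inner bracket has \<open>l\<close>-part 0 and \<open>a_0\<close>-part
  \<open>alpha t t'\<close>, so the third-order terms are multiples of \<open>flat t\<close> and
  \<open>flat t'\<close>.\<close>

lemma d0_mult_eq:
  "d0_mult (z, s, t) (z', s', t') =
     (z + z' + (1/2) *\<^sub>R (s *\<^sub>R flat t' - s' *\<^sub>R flat t) + (alpha t t' / 12) *\<^sub>R (flat t' - flat t),
      s + s' + alpha t t' / 2, t + t')"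
  by (simp add: d0_mult_def d0_br_def flat_simps alpha_simps algebra_simps)

lemma d0_mult_central: "d0_mult u (u' + (h, 0, 0)) = d0_mult u u' + (h, 0, 0)"
  "d0_mult (u + (h, 0, 0)) u' = d0_mult u u' + (h, 0, 0)"
  by (cases u; cases u'; simp add: d0_mult_eq algebra_simps)+

text \<open>In exponential coordinates inversion is negation, all brackets of an element with its
  negative being zero.\<close>

lemma d0_mult_minus: "d0_mult u (- u) = 0"
  by (cases u) (simp add: d0_mult_eq flat_simps alpha_simps zero_prod_def)

context plane_basis
begin

text \<open>Equal to \<open>alpha e1 e2\<close>, hence the step of the values of
  \<open>alpha\<close> on \<open>L\<close>.\<close>

definition \<kappa> where "\<kappa> = (2 * pi)\<^sup>2 / d"

text \<open>The generators of \<open>L\<close> satisfy \<open>\<kappa> e\<^sub>1\<^sup>\<flat> = \<tau> v\<close> and \<open>\<kappa> e\<^sub>2\<^sup>\<flat> = - \<tau> u\<close>; the denominators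
  2 and 12 in the lattice come from the Baker-Campbell-Hausdorff formula.\<close>

definition \<tau> where "\<tau> = (2 * pi) ^ 3 / d\<^sup>2"
definition Z where "Z = int_span ((\<tau> / 12) *\<^sub>R u) ((\<tau> / 12) *\<^sub>R v)"
definition \<Delta> where "\<Delta> = Z \<times> int_multiples (\<kappa> / 2) \<times> L"

lemma \<tau>_pos: "\<tau> > 0"
  using d_nz by (simp add: \<tau>_def)

lemma \<kappa>_nz: "\<kappa> \<noteq> 0"
  using d_nz by (simp add: \<kappa>_def)

lemma Z_basis_nz: "alpha ((\<tau> / 12) *\<^sub>R u) ((\<tau> / 12) *\<^sub>R v) \<noteq> 0"
  using alpha_uv \<tau>_pos by (simp add: alpha_simps)

text \<open>\<open>flat\<close> is a quarter turn, and so is the passage to the dual vectors, up to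
  scale; composing them returns to multiples of \<open>v\<close> and \<open>- u\<close>. The
  resulting scale is \<open>\<kappa> * (2 * pi / d) = \<tau>\<close>.\<close>

lemma flat_L:
  assumes "t \<in> L"
  shows "(\<kappa> / 12) *\<^sub>R flat t \<in> Z"
proof -
  obtain m n where t: "t = of_int m *\<^sub>R e1 + of_int n *\<^sub>R e2"
    using assms unfolding L_def int_span_iff by blast
  have "flat e1 = (2 * pi / d) *\<^sub>R v" "flat e2 = - (2 * pi / d) *\<^sub>R u"
    by (simp_all add: flat_eq vec_eq_iff forall_2 e1_def e2_def)
  moreover have "\<kappa> * (2 * pi / d) = \<tau>"
    by (simp add: \<kappa>_def \<tau>_def power2_eq_square power3_eq_cube)
  ultimately have "\<kappa> *\<^sub>R flat e1 = \<tau> *\<^sub>R v" "\<kappa> *\<^sub>R flat e2 = - \<tau> *\<^sub>R u"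
    by (simp_all flip: scaleR_minus_left)
  then have "(1 / 12) *\<^sub>R \<kappa> *\<^sub>R flat e1 = (1 / 12) *\<^sub>R \<tau> *\<^sub>R v"
    "(1 / 12) *\<^sub>R \<kappa> *\<^sub>R flat e2 = (1 / 12) *\<^sub>R (- \<tau> *\<^sub>R u)"
    by simp_all
  then have e: "(\<kappa> / 12) *\<^sub>R flat e1 = (\<tau> / 12) *\<^sub>R v" "(\<kappa> / 12) *\<^sub>R flat e2 = - ((\<tau> / 12) *\<^sub>R u)"
    by simp_all
  have "(\<kappa> / 12) *\<^sub>R flat t = of_int m *\<^sub>R (\<kappa> / 12) *\<^sub>R flat e1 + of_int n *\<^sub>R (\<kappa> / 12) *\<^sub>R flat e2"
    by (simp add: t flat_simps algebra_simps)
  also have "\<dots> = of_int m *\<^sub>R ((\<tau> / 12) *\<^sub>R v) + of_int n *\<^sub>R (- ((\<tau> / 12) *\<^sub>R u))"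
    by (simp only: e)
  also have "\<dots> \<in> Z"
    unfolding Z_def by (intro int_span_add int_span_scale int_span_minus int_span_basis)
  finally show ?thesis .
qed

lemma alpha_L:
  assumes "t \<in> L" "t' \<in> L"
  shows "alpha t t' \<in> int_multiples \<kappa>"
proof -
  obtain m n where t: "t = of_int m *\<^sub>R e1 + of_int n *\<^sub>R e2"
    using assms unfolding L_def int_span_iff by blast
  obtain k l where t': "t' = of_int k *\<^sub>R e1 + of_int l *\<^sub>R e2"
    using assms unfolding L_def int_span_iff by blast
  have "alpha e2 e1 = - alpha e1 e2"
    by (simp add: alpha_def)
  then have "alpha t t' = \<kappa> * of_int (m * l - n * k)"
    by (simp add: t t' alpha_simps \<kappa>_def[folded alpha_dual_basis] algebra_simps)
  then show ?thesis
    unfolding int_multiples_iff by blast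
qed

lemma \<Delta>_mult:
  assumes "x \<in> \<Delta>" "y \<in> \<Delta>"
  shows "d0_mult x y \<in> \<Delta>"
proof -
  obtain z s t z' s' t' where xy: "x = (z, s, t)" "y = (z', s', t')"
    and in_fac: "z \<in> Z" "z' \<in> Z" "s \<in> int_multiples (\<kappa> / 2)" "s' \<in> int_multiples (\<kappa> / 2)" "t \<in> L" "t' \<in> L"
    using assms by (auto simp: \<Delta>_def)
  obtain i i' k where s: "s = \<kappa> / 2 * of_int i" "s' = \<kappa> / 2 * of_int i'" and k: "alpha t t' = \<kappa> * of_int k"
    using in_fac(3,4) alpha_L[OF in_fac(5,6)] unfolding int_multiples_iff by blast
  let ?W = "\<lambda>t. (\<kappa> / 12) *\<^sub>R flat t"
  \<comment> \<open>The coefficient 3 arises because half of \<open>\<kappa> / 2\<close> is three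
    times \<open>\<kappa> / 12\<close>; the summand \<open>k\<close> is the third-order
    term.\<close>
  have "(1/2) *\<^sub>R (s *\<^sub>R flat t' - s' *\<^sub>R flat t) + (alpha t t' / 12) *\<^sub>R (flat t' - flat t)
      = of_int (3 * i + k) *\<^sub>R ?W t' - of_int (3 * i' + k) *\<^sub>R ?W t"
    unfolding s k by (simp add: algebra_simps vec_eq_iff)
  moreover have "z + z' + (of_int (3 * i + k) *\<^sub>R ?W t' - of_int (3 * i' + k) *\<^sub>R ?W t) \<in> Z"
    using in_fac flat_L unfolding Z_def
    by (intro int_span_add int_span_diff int_span_scale)
  moreover have "s + s' + alpha t t' / 2 \<in> int_multiples (\<kappa> / 2)"
    unfolding s k int_multiples_iff by (intro exI[of _ "i + i' + k"]) (simp add: algebra_simps)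
  moreover have "t + t' \<in> L"
    using in_fac by (simp add: L_def int_span_add)
  ultimately show ?thesis
    by (simp add: xy d0_mult_eq \<Delta>_def add.assoc)
qed

lemma \<Delta>_minus: "x \<in> \<Delta> \<Longrightarrow> - x \<in> \<Delta>"
  by (auto simp: \<Delta>_def Z_def L_def int_span_minus int_multiples_minus)

lemma \<Delta>_0: "0 \<in> \<Delta>"
  by (auto simp: \<Delta>_def Z_def L_def int_span_0 int_multiples_iff zero_prod_def intro: exI[of _ 0])

lemma \<Delta>_central:
  assumes "x \<in> \<Delta>" "h \<in> Z"
  shows "x + (h, 0, 0) \<in> \<Delta>"
  using assms by (auto simp: \<Delta>_def Z_def int_span_add)

lemma uniformly_discrete_\<Delta>: "uniformly_discrete \<Delta>"
proof -
  have "uniformly_discrete (int_multiples (\<kappa> / 2))"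
    using uniformly_discrete_int_multiples[of "\<bar>\<kappa> / 2\<bar>"] \<kappa>_nz unfolding int_multiples_abs by simp
  then show ?thesis
    unfolding \<Delta>_def Z_def L_def
    by (intro uniformly_discrete_Times uniformly_discrete_int_span Z_basis_nz alpha_dual_basis_nz)
qed

lemma \<Delta>_cobounded:
  obtains K where "compact K" "\<And>x. \<exists>k\<in>K. \<exists>\<delta>\<in>\<Delta>. x = d0_mult k \<delta>"
proof -
  obtain B1 where B1: "\<And>x. \<exists>y\<in>Z. norm (x - y) \<le> B1"
    using coboundedE[OF cobounded_int_span[OF Z_basis_nz]] unfolding Z_def by metis
  have "cobounded (int_multiples (\<kappa> / 2))"
    using cobounded_int_multiples[of "\<bar>\<kappa> / 2\<bar>"] \<kappa>_nz unfolding int_multiples_abs by simp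
  then obtain B2 where B2: "\<And>x. \<exists>y\<in>int_multiples (\<kappa> / 2). norm (x - y) \<le> B2"
    using coboundedE by metis
  obtain B3 where B3: "\<And>x. \<exists>y\<in>L. norm (x - y) \<le> B3"
    using coboundedE[OF cobounded_int_span[OF alpha_dual_basis_nz]] unfolding L_def by metis
  define K where "K = (cball 0 B1 \<times> cball 0 B2 \<times> cball 0 B3 :: ((real^2) \<times> real \<times> (real^2)) set)"
  have "\<exists>k\<in>K. \<exists>\<delta>\<in>\<Delta>. x = d0_mult k \<delta>" for x
  proof -
    obtain z s t where x: "x = (z, s, t)" by (cases x)
    obtain t' where t': "t' \<in> L" "norm (t - t') \<le> B3" using B3 by blast
    \<comment> \<open>\<open>p\<close> and \<open>w\<close> are what is left of \<open>s\<close> and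
      \<open>z\<close> after removing the Baker-Campbell-Hausdorff corrections, which depend only on
      components chosen earlier.\<close>
    define p where "p = s - alpha (t - t') t' / 2"
    obtain s' where s': "s' \<in> int_multiples (\<kappa> / 2)" "norm (p - s') \<le> B2" using B2 by blast
    define w where "w = z - (1/2) *\<^sub>R ((p - s') *\<^sub>R flat t' - s' *\<^sub>R flat (t - t'))
        - (alpha (t - t') t' / 12) *\<^sub>R (flat t' - flat (t - t'))"
    obtain z' where z': "z' \<in> Z" "norm (w - z') \<le> B1" using B1 by blast
    have "x = d0_mult (w - z', p - s', t - t') (z', s', t')"
      by (simp add: x d0_mult_eq) (simp add: p_def w_def)
    moreover have "(w - z', p - s', t - t') \<in> K" "(z', s', t') \<in> \<Delta>"
      using t' s' z' by (simp_all add: K_def \<Delta>_def)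
    ultimately show ?thesis by blast
  qed
  moreover have "compact K"
    unfolding K_def by (intro compact_Times compact_cball)
  ultimately show ?thesis
    using that by blast
qed

lemma \<Delta>_lattice: "is_lattice_in d0_mult d0_one \<Delta>"
proof -
  have "is_subgroup d0_mult d0_one \<Delta>"
    unfolding is_subgroup_def d0_one_def
    using \<Delta>_mult \<Delta>_minus \<Delta>_0 d0_mult_minus by blast
  moreover have "cocompact d0_mult \<Delta>"
    unfolding cocompact_def using \<Delta>_cobounded by metis
  ultimately show ?thesis
    by (simp add: is_lattice_in_def uniformly_discrete_imp_discrete_set uniformly_discrete_\<Delta>)
qed

end

text \<open>The lattice \<open>\<Delta>\<close> is available for any basis of the plane; the
  standard one is taken.\<close>

lemma D0_lattice: "admits_lattice d0_mult d0_one"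
proof -
  interpret plane_basis "axis 1 1" "axis 2 1"
    by unfold_locales (simp add: alpha_def axis_def)
  show ?thesis
    unfolding admits_lattice_def using \<Delta>_lattice by blast
qed

section \<open>A lattice in \<open>D_q\<close>\<close>

lemma D_mult_eq:
  "D_mult \<mu> (u, a) (u', a') = (d0_mult u u' + ((1/2) *\<^sub>R omega \<mu> a (rot \<mu> (snd (snd u)) a'), 0, 0),
     a + rot \<mu> (snd (snd u)) a')"
  by (simp add: D_mult_def)

text \<open>The lattice \<open>\<Delta>\<close> of \<open>D_0\<close> is enlarged by scaled Gaussian
  integers. Its elements act trivially on them, so the point is to fit half of \<open>omega\<close>
  into \<open>Z\<close>.\<close>

lemma D_lattice:
  assumes "range \<mu> \<subseteq> int_span u v" "alpha u v \<noteq> 0"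
  shows "admits_lattice (D_mult \<mu>) D_one"
proof -
  interpret plane_basis u v
    by unfold_locales fact
  \<comment> \<open>\<open>omega\<close> scales quadratically, so its values lie in
    \<open>\<tau>\<close> times the weight lattice, that is, in 12 times \<open>Z\<close>; halving
    leaves a factor 6.\<close>
  define c where "c = sqrt \<tau>"
  have c: "c > 0" "c\<^sup>2 = \<tau>"
    using \<tau>_pos by (auto simp: c_def)
  define A where "A = (gauss_lattice c :: (complex^'a) set)"
  define \<Gamma> where "\<Gamma> = \<Delta> \<times> A"
  have half: "(1/2) *\<^sub>R omega \<mu> a b \<in> Z" if "a \<in> A" "b \<in> A" for a b
  proof -
    have "(1/12) *\<^sub>R omega \<mu> a b \<in> int_span ((1/12) *\<^sub>R c\<^sup>2 *\<^sub>R u) ((1/12) *\<^sub>R c\<^sup>2 *\<^sub>R v)"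
      using that assms(1) by (intro int_span_scaled_basis omega_gauss_lattice) (simp_all add: A_def)
    then have "(1/12) *\<^sub>R omega \<mu> a b \<in> Z"
      by (simp add: Z_def c)
    from int_span_scale[OF this[unfolded Z_def], of 6] show ?thesis
      by (simp add: Z_def)
  qed
  have rot_\<Delta>: "rot \<mu> (snd (snd x)) a = a" if "x \<in> \<Delta>" for x a
    using that rot_L[OF assms(1)] by (auto simp: \<Delta>_def)
  have "D_mult \<mu> x y \<in> \<Gamma>" if \<Gamma>: "x \<in> \<Gamma>" "y \<in> \<Gamma>" for x y
  proof -
    obtain p a p' a' where xy: "x = (p, a)" "y = (p', a')" "p \<in> \<Delta>" "p' \<in> \<Delta>" "a \<in> A" "a' \<in> A"
      using \<Gamma> by (auto simp: \<Gamma>_def)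
    then have "D_mult \<mu> x y = (d0_mult p p' + ((1/2) *\<^sub>R omega \<mu> a a', 0, 0), a + a')"
      by (simp add: D_mult_eq rot_\<Delta>)
    moreover have "d0_mult p p' + ((1/2) *\<^sub>R omega \<mu> a a', 0, 0) \<in> \<Delta>"
      using xy by (intro \<Delta>_central \<Delta>_mult half)
    moreover have "a + a' \<in> A"
      using xy by (simp add: A_def gauss_lattice_add)
    ultimately show ?thesis by (simp add: \<Gamma>_def)
  qed
  moreover have "\<exists>y\<in>\<Gamma>. D_mult \<mu> x y = D_one" if \<Gamma>: "x \<in> \<Gamma>" for x
  proof -
    obtain p a where x: "x = (p, a)" "p \<in> \<Delta>" "a \<in> A"
      using \<Gamma> by (auto simp: \<Gamma>_def)
    have "D_mult \<mu> x (- p, - a) = D_one"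
      using x by (simp add: D_mult_eq D_one_def rot_\<Delta> omega_simps d0_mult_minus zero_prod_def)
    moreover have "(- p, - a) \<in> \<Gamma>"
      using x by (auto simp: \<Gamma>_def A_def \<Delta>_minus gauss_lattice_minus)
    ultimately show ?thesis by blast
  qed
  moreover have "D_one \<in> \<Gamma>"
    by (simp add: D_one_def \<Gamma>_def A_def \<Delta>_0 gauss_lattice_0)
  ultimately have "is_subgroup (D_mult \<mu>) D_one \<Gamma>"
    unfolding is_subgroup_def by blast
  moreover have "discrete_set \<Gamma>"
    unfolding \<Gamma>_def A_def
    by (intro uniformly_discrete_imp_discrete_set uniformly_discrete_Times uniformly_discrete_\<Delta>
        uniformly_discrete_gauss_lattice c(1))
  moreover have "cocompact (D_mult \<mu>) \<Gamma>"
  proof -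
    obtain B1 where B1: "\<And>x. \<exists>y\<in>Z. norm (x - y) \<le> B1"
      using coboundedE[OF cobounded_int_span[OF Z_basis_nz]] unfolding Z_def by metis
    obtain B2 where B2: "\<And>x. \<exists>y\<in>A. norm (x - y) \<le> B2"
      using coboundedE[OF cobounded_gauss_lattice[OF c(1), where 'q='a]] unfolding A_def by metis
    obtain K0 where "compact K0" and K0: "\<And>x. \<exists>k\<in>K0. \<exists>\<delta>\<in>\<Delta>. x = d0_mult k \<delta>"
      using \<Delta>_cobounded by blast
    \<comment> \<open>The compact set for \<open>D_0\<close> is thickened along \<open>z\<close>,
      where the \<open>omega\<close> term of the product has to be absorbed.\<close>
    define K1 where "K1 = (\<lambda>(x, y). x + y) ` (K0 \<times> ((cball 0 B1 :: (real^2) set) \<times> {0 :: real} \<times> {0 :: real^2}))"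
    define K where "K = K1 \<times> (cball 0 B2 :: (complex^'a) set)"
    have "\<exists>k\<in>K. \<exists>\<gamma>\<in>\<Gamma>. g = D_mult \<mu> k \<gamma>" for g
    proof -
      obtain p a where g: "g = (p, a)" by (cases g)
      obtain k \<delta> where k: "k \<in> K0" "\<delta> \<in> \<Delta>" "p = d0_mult k \<delta>" using K0 by blast
      define t where "t = snd (snd k)"
      obtain a' where a': "a' \<in> A" "norm (rot \<mu> (- t) a - a') \<le> B2" using B2 by blast
      define b where "b = a - rot \<mu> t a'"
      have "b = rot \<mu> t (rot \<mu> (- t) a - a')"
        unfolding b_def rot_simps(6) rot_simps(3) by (simp add: rot_simps)
      then have b: "norm b \<le> B2"
        using a'(2) by simp
      \<comment> \<open>\<open>w\<close> is the central term that the product creates. Rounding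
        \<open>- w\<close> to \<open>h\<close> and using centrality, \<open>- w - h\<close> goes to
        the compact factor and \<open>h\<close> to the lattice factor.\<close>
      define w where "w = (1/2) *\<^sub>R omega \<mu> b (rot \<mu> t a')"
      obtain h where h: "h \<in> Z" "norm (- w - h) \<le> B1" using B1 by blast
      have "g = D_mult \<mu> (k + (- w - h, 0, 0), b) (\<delta> + (h, 0, 0), a')"
        by (simp add: D_mult_eq g k(3) d0_mult_central t_def[symmetric] w_def[symmetric]) (simp add: b_def zero_prod_def)
      moreover have "k + (- w - h, 0, 0) \<in> K1"
        unfolding K1_def using k(1) h by (intro image_eqI[of _ _ "(k, (- w - h, 0, 0))"]) auto
      then have "(k + (- w - h, 0, 0), b) \<in> K"
        using b by (simp add: K_def)
      moreover have "(\<delta> + (h, 0, 0), a') \<in> \<Gamma>"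
        using h a' k by (simp add: \<Gamma>_def \<Delta>_central)
      ultimately show ?thesis by blast
    qed
    moreover have "compact K"
      unfolding K_def K1_def using \<open>compact K0\<close>
      by (intro compact_Times compact_cball compact_continuous_image compact_sing)
         (auto simp: case_prod_unfold intro!: continuous_intros)
    ultimately show ?thesis
      unfolding cocompact_def by blast
  qed
  ultimately show ?thesis
    unfolding admits_lattice_def is_lattice_in_def by blast
qed

section \<open>Weights of a group with a lattice\<close>

text \<open>Simultaneous Dirichlet approximation of all
  \<open>\<mu> j \<bullet> t / (2 * pi)\<close> with a common multiplier.\<close>

lemma small_rotation_multiple:
  fixes \<mu> :: "'q::finite \<Rightarrow> real^2"
  obtains n :: nat where "n > 0" "\<And>j. cmod (exp (\<i> * complex_of_real (\<mu> j \<bullet> (real n *\<^sub>R t))) - 1) < 1"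
proof -
  obtain f where f: "bij_betw f {0..<CARD('q)} (UNIV :: 'q set)"
    using ex_bij_betw_nat_finite finite by blast
  \<comment> \<open>Accuracy 1/8 suffices: the resulting error in the angle is below
    \<open>2 * pi / 8 < 1\<close>.\<close>
  obtain q p where "0 < q"
    and p: "\<And>i. i < CARD('q) \<Longrightarrow> \<bar>of_int q * (\<mu> (f i) \<bullet> t / (2 * pi)) - of_int (p i)\<bar> < 1 / real 8"
    using Dirichlet_approx_simult[of 8 "CARD('q)" "\<lambda>i. \<mu> (f i) \<bullet> t / (2 * pi)"] zero_less_numeral by metis
  have "cmod (exp (\<i> * complex_of_real (\<mu> j \<bullet> (real (nat q) *\<^sub>R t))) - 1) < 1" for j
  proof -
    obtain i where i: "i < CARD('q)" "j = f i"
      using f by (metis UNIV_I atLeastLessThan_iff bij_betw_imp_surj_on imageE)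
    define x where "x = of_int q * (\<mu> j \<bullet> t) - of_int (p i) * (2 * pi)"
    have "x = (2 * pi) * (of_int q * (\<mu> (f i) \<bullet> t / (2 * pi)) - of_int (p i))"
      by (simp add: x_def i right_diff_distrib)
    then have "\<bar>x\<bar> = (2 * pi) * \<bar>of_int q * (\<mu> (f i) \<bullet> t / (2 * pi)) - of_int (p i)\<bar>"
      by (simp add: abs_mult)
    also have "\<dots> < (2 * pi) * (1 / real 8)"
      by (intro mult_strict_left_mono p i) simp
    also have "\<dots> < 1"
      using pi_less_4 by simp
    finally have "\<bar>x\<bar> < 1" .
    have "\<mu> j \<bullet> (real (nat q) *\<^sub>R t) = x + of_int (p i) * (2 * pi)"
      using \<open>0 < q\<close> by (simp add: x_def)
    then have "exp (\<i> * complex_of_real (\<mu> j \<bullet> (real (nat q) *\<^sub>R t)))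
        = exp (\<i> * complex_of_real x) * exp (\<i> * complex_of_real (of_int (p i) * (2 * pi)))"
      by (simp only: of_real_add distrib_left exp_add)
    then have "exp (\<i> * complex_of_real (\<mu> j \<bullet> (real (nat q) *\<^sub>R t))) = exp (\<i> * complex_of_real x)"
      by (simp only: exp_int_mult_2pi mult_1_right)
    \<comment> \<open>A chord is no longer than its arc.\<close>
    moreover have "cmod (exp (\<i> * complex_of_real x) - 1) \<le> \<bar>x\<bar>"
      using abs_sin_x_le_abs_x[of "x / 2"] by (simp add: dist_exp_i_1)
    ultimately show ?thesis
      using \<open>\<bar>x\<bar> < 1\<close> by simp
  qed
  then show ?thesis
    using that[of "nat q"] \<open>0 < q\<close> by simp
qed

lemma tendsto_omega:
  assumes "(f \<longlongrightarrow> a) F" "(g \<longlongrightarrow> b) F"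
  shows "((\<lambda>k. omega \<mu> (f k) (g k)) \<longlongrightarrow> omega \<mu> a b) F"
  unfolding omega_eq_sum using assms by (intro tendsto_intros)

text \<open>\<open>step\<close> is the commutator with a fixed element over \<open>t\<close>. On
  \<open>a\<close>-components it multiplies coordinate \<open>j\<close> by a number of modulus below
  1, so the iterates tend to 0 and, by isolation of 0 in \<open>S\<close>, some iterate equals
  0.\<close>

lemma heisenberg_contraction:
  fixes S :: "((real^2) \<times> (complex^'q::finite)) set"
  assumes "open U" "0 \<in> U" "U \<inter> S \<subseteq> {0}"
    and step: "\<And>w b. (w, b) \<in> S \<Longrightarrow>
      (omega \<mu> a (rot \<mu> t b) - (1/2) *\<^sub>R omega \<mu> (rot \<mu> t b) b, rot \<mu> t b - b) \<in> S"
    and small: "\<And>j. cmod (exp (\<i> * complex_of_real (\<mu> j \<bullet> t)) - 1) < 1"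
    and "(w, b) \<in> S"
  shows "rot \<mu> t b = b"
proof -
  define \<xi> where "\<xi> j = exp (\<i> * complex_of_real (\<mu> j \<bullet> t))" for j
  define c :: "nat \<Rightarrow> complex^'q" where "c k = (\<chi> j. (\<xi> j - 1) ^ k * b $ j)" for k
  \<comment> \<open>The new central component depends only on the previous
    \<open>a\<close>-component, so it converges along with \<open>c\<close>.\<close>
  define W where "W k = omega \<mu> a (rot \<mu> t (c k)) - (1/2) *\<^sub>R omega \<mu> (rot \<mu> t (c k)) (c k)" for k
  have c_Suc: "rot \<mu> t (c k) - c k = c (Suc k)" for k
    by (simp add: c_def vec_eq_iff rot_nth \<xi>_def[symmetric] algebra_simps)
  have "\<exists>w. (w, c k) \<in> S" for k
  proof (induction k)
    case 0
    have "c 0 = b" by (simp add: c_def vec_eq_iff)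
    then show ?case using assms(6) by blast
  next
    case (Suc k)
    then show ?case using step c_Suc by metis
  qed
  then have in_S: "(W k, c (Suc k)) \<in> S" for k
    using step c_Suc unfolding W_def by metis
  have "(\<lambda>k. (\<xi> j - 1) ^ k * b $ j) \<longlonglongrightarrow> 0 * b $ j" for j
    using small unfolding \<xi>_def by (intro tendsto_intros LIMSEQ_power_zero) simp
  then have c: "c \<longlonglongrightarrow> 0"
    by (intro vec_tendstoI) (simp add: c_def)
  have "(\<lambda>k. norm (rot \<mu> t (c k))) \<longlonglongrightarrow> 0"
    using tendsto_norm_zero[OF c] by simp
  then have rot_c: "(\<lambda>k. rot \<mu> t (c k)) \<longlonglongrightarrow> 0"
    by (rule tendsto_norm_zero_cancel)
  have "W \<longlonglongrightarrow> omega \<mu> a 0 - (1/2) *\<^sub>R omega \<mu> (0 :: complex^'q) 0"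
    unfolding W_def by (intro tendsto_intros tendsto_omega rot_c c)
  then have "(\<lambda>k. (W k, c (Suc k))) \<longlonglongrightarrow> (0, 0)"
    using LIMSEQ_Suc[OF c] by (intro tendsto_Pair) (simp_all add: omega_simps)
  then have "\<forall>\<^sub>F k in sequentially. (W k, c (Suc k)) \<in> U"
    using assms(1,2) by (simp add: topological_tendstoD zero_prod_def)
  then obtain k where "(W k, c (Suc k)) \<in> U"
    unfolding eventually_sequentially by blast
  then have "c (Suc k) = 0"
    using in_S[of k] assms(3) by (auto simp: zero_prod_def)
  \<comment> \<open>A positive power of \<open>\<xi> j - 1\<close> kills \<open>b $ j\<close>, hence
    so does \<open>\<xi> j - 1\<close> itself.\<close>
  then have "(\<xi> j - 1) * b $ j = 0" for j
    by (auto simp: c_def vec_eq_iff)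
  then show ?thesis
    by (simp add: vec_eq_iff rot_nth \<xi>_def left_diff_distrib)
qed

text \<open>\<open>2 * pi\<close> times the basis dual to \<open>t, s\<close> spans the lattice: the
  coordinates of \<open>\<mu> j\<close> in it are its pairings with \<open>t\<close> and
  \<open>s\<close> divided by \<open>2 * pi\<close>.\<close>

lemma plane_lattice_of_dual_vectors:
  assumes "alpha t s \<noteq> 0"
    and "\<And>j. \<exists>m. \<mu> j \<bullet> t = of_int m * (2 * pi)" "\<And>j. \<exists>n. \<mu> j \<bullet> s = of_int n * (2 * pi)"
  shows "\<exists>\<Lambda>. plane_lattice \<Lambda> \<and> range \<mu> \<subseteq> \<Lambda>"
proof -
  define u :: "real^2" where "u = (2 * pi / alpha t s) *\<^sub>R vector [s $ 2, - s $ 1]"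
  define v :: "real^2" where "v = (2 * pi / alpha t s) *\<^sub>R vector [- t $ 2, t $ 1]"
  have "alpha u v = (2 * pi / alpha t s)\<^sup>2 * alpha t s"
    by (simp add: u_def v_def alpha_simps power2_eq_square) (simp add: alpha_def mult.commute)
  then have "alpha u v \<noteq> 0"
    using assms(1) by simp
  have expand: "x = (x \<bullet> t / (2 * pi)) *\<^sub>R u + (x \<bullet> s / (2 * pi)) *\<^sub>R v" for x
  proof -
    have "alpha t s *\<^sub>R x = (x \<bullet> t) *\<^sub>R vector [s $ 2, - s $ 1] + (x \<bullet> s) *\<^sub>R vector [- t $ 2, t $ 1]"
      by (simp add: vec_eq_iff forall_2 alpha_def inner_vec_def sum_2 algebra_simps)
    then have "(1 / alpha t s) *\<^sub>R alpha t s *\<^sub>R x = (1 / alpha t s) *\<^sub>R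
        ((x \<bullet> t) *\<^sub>R vector [s $ 2, - s $ 1] + (x \<bullet> s) *\<^sub>R vector [- t $ 2, t $ 1])"
      by (rule arg_cong)
    then show ?thesis
      using assms(1) by (simp add: u_def v_def scaleR_add_right)
  qed
  have "\<mu> j \<in> int_span u v" for j
  proof -
    obtain m n where "\<mu> j \<bullet> t = of_int m * (2 * pi)" "\<mu> j \<bullet> s = of_int n * (2 * pi)"
      using assms(2,3) by meson
    then have "\<mu> j = of_int m *\<^sub>R u + of_int n *\<^sub>R v"
      using expand[of "\<mu> j"] by simp
    then show ?thesis
      unfolding int_span_iff by blast
  qed
  then show ?thesis
    using \<open>alpha u v \<noteq> 0\<close> plane_lattice_iff by blast
qed

text \<open>Common setting for both groups: \<open>P\<close> is the image of the lattice after
  forgetting \<open>z\<close>, and \<open>a_0\<close> in the case of \<open>D_q\<close>. Such an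
  image can fail to be discrete; \<open>small_fixes\<close> records what discreteness upstairs
  implies for it.\<close>

locale cobounded_motion_group =
  fixes \<mu> :: "'q::finite \<Rightarrow> real^2" and P :: "((complex^'q) \<times> (real^2)) set" and B :: real
  assumes mult: "\<And>a t b s. (a, t) \<in> P \<Longrightarrow> (b, s) \<in> P \<Longrightarrow> (a + rot \<mu> t b, t + s) \<in> P"
    and inverse: "\<And>a t. (a, t) \<in> P \<Longrightarrow> (- rot \<mu> (- t) a, - t) \<in> P"
    and cobounded: "\<And>a t. \<exists>b s c r. (c, r) \<in> P \<and> norm b \<le> B \<and> norm s \<le> B \<and>
      a = b + rot \<mu> s c \<and> t = s + r"
    and small_fixes: "\<And>a t b. (a, t) \<in> P \<Longrightarrow>
      (\<And>j. cmod (exp (\<i> * complex_of_real (\<mu> j \<bullet> t)) - 1) < 1) \<Longrightarrow> (b, 0) \<in> P \<Longrightarrow> rot \<mu> t b = b"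
begin

lemma B_nonneg: "B \<ge> 0"
  using cobounded[of 0 0] by (meson norm_ge_zero order_trans)

text \<open>The two products in either order lie over the same \<open>t + s\<close>; one is
  multiplied by the inverse of the other.\<close>

lemma commutator:
  assumes "(a, t) \<in> P" "(b, s) \<in> P"
  shows "(b + rot \<mu> s a - (a + rot \<mu> t b), 0) \<in> P"
proof -
  have "(b + rot \<mu> s a, s + t) \<in> P" "(- rot \<mu> (- (t + s)) (a + rot \<mu> t b), - (t + s)) \<in> P"
    using assms mult inverse by blast+
  from mult[OF this] show ?thesis
    by (simp add: rot_simps algebra_simps)
qed

text \<open>If \<open>\<xi> \<noteq> 1\<close>, a fixed commutator has vanishing coordinate
  \<open>j\<close>, which reads \<open>(1 - \<xi>) * b $ j = (1 - \<psi>) * a $ j\<close>. This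
  bounds coordinate \<open>j\<close> on all of \<open>P\<close>, against coboundedness.\<close>

lemma exp_i_weight_eq_1:
  assumes at: "(a, t) \<in> P"
    and small: "\<And>j. cmod (exp (\<i> * complex_of_real (\<mu> j \<bullet> t)) - 1) < 1"
  shows "exp (\<i> * complex_of_real (\<mu> j \<bullet> t)) = 1"
proof (rule ccontr)
  define \<xi> where "\<xi> = exp (\<i> * complex_of_real (\<mu> j \<bullet> t))"
  assume "exp (\<i> * complex_of_real (\<mu> j \<bullet> t)) \<noteq> 1"
  then have \<xi>: "cmod (1 - \<xi>) > 0"
    by (simp add: \<xi>_def)
  define M where "M = 2 * cmod (a $ j) / cmod (1 - \<xi>)"
  have bound: "cmod (b $ j) \<le> M" if "(b, s) \<in> P" for b s
  proof -
    define \<psi> where "\<psi> = exp (\<i> * complex_of_real (\<mu> j \<bullet> s))"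
    define x where "x = b + rot \<mu> s a - (a + rot \<mu> t b)"
    have "rot \<mu> t x = x"
      unfolding x_def by (intro small_fixes[OF at small] commutator at that)
    then have "\<xi> * x $ j = x $ j"
      by (metis \<xi>_def rot_nth)
    then have "x $ j = 0"
      using \<xi> by auto
    then have "(1 - \<xi>) * b $ j = (1 - \<psi>) * a $ j"
      by (simp add: x_def rot_nth \<xi>_def[symmetric] \<psi>_def[symmetric] algebra_simps)
    then have "cmod (1 - \<xi>) * cmod (b $ j) = cmod (1 - \<psi>) * cmod (a $ j)"
      by (metis norm_mult)
    also have "\<dots> \<le> 2 * cmod (a $ j)"
      using norm_triangle_ineq4[of 1 \<psi>] by (intro mult_right_mono) (simp_all add: \<psi>_def)
    finally show ?thesis
      using \<xi> by (simp add: M_def field_simps)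
  qed
  have "M \<ge> 0"
    using \<xi> by (simp add: M_def)
  \<comment> \<open>The length exceeds what the bounded factor (\<open>B\<close>) and the factor
    from \<open>P\<close> (\<open>M\<close>) can contribute together.\<close>
  obtain b s c r where cr: "(c, r) \<in> P" and b: "norm b \<le> B"
    and eq: "axis j (complex_of_real (B + M + 1)) = b + rot \<mu> s c"
    using cobounded[of "axis j (complex_of_real (B + M + 1))" 0] by blast
  have "complex_of_real (B + M + 1) = b $ j + rot \<mu> s c $ j"
    using arg_cong[OF eq, of "\<lambda>x. x $ j"] by (simp add: axis_def)
  then have "cmod (complex_of_real (B + M + 1)) \<le> cmod (b $ j) + cmod (rot \<mu> s c $ j)"
    using norm_triangle_ineq by metis
  also have "\<dots> \<le> B + M"
    using b Finite_Cartesian_Product.norm_nth_le[of b j] bound[OF cr]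
    by (simp add: rot_nth norm_mult)
  finally show False
    using B_nonneg \<open>M \<ge> 0\<close> by (simp only: norm_of_real)
qed

lemma power:
  assumes "(a, t) \<in> P"
  shows "\<exists>b. (b, real (Suc n) *\<^sub>R t) \<in> P"
proof (induction n)
  case 0
  then show ?case using assms by auto
next
  case (Suc n)
  then obtain b where "(b, real (Suc n) *\<^sub>R t) \<in> P" by blast
  from mult[OF this assms]
  have "(b + rot \<mu> (real (Suc n) *\<^sub>R t) a, real (Suc n) *\<^sub>R t + t) \<in> P" .
  moreover have "real (Suc n) *\<^sub>R t + t = real (Suc (Suc n)) *\<^sub>R t"
    by (simp only: of_nat_Suc scaleR_left_distrib scaleR_one add_ac)
  ultimately show ?case
    by metis
qed

text \<open>Some positive power is small by Dirichlet approximation, and small elements have all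
  angles in 2 pi Z.\<close>

lemma integral_multiple:
  assumes "(a, t) \<in> P"
  obtains n where "n > 0" "\<And>j. \<exists>m. \<mu> j \<bullet> (real n *\<^sub>R t) = of_int m * (2 * pi)"
proof -
  obtain n :: nat where n: "n > 0"
    "\<And>j. cmod (exp (\<i> * complex_of_real (\<mu> j \<bullet> (real n *\<^sub>R t))) - 1) < 1"
    using small_rotation_multiple[of \<mu> t] by blast
  obtain b where "(b, real n *\<^sub>R t) \<in> P"
    using power[OF assms, of "n - 1"] n(1) by auto
  then have "exp (\<i> * complex_of_real (\<mu> j \<bullet> (real n *\<^sub>R t))) = 1" for j
    using exp_i_weight_eq_1 n(2) by blast
  then have "\<exists>m. \<mu> j \<bullet> (real n *\<^sub>R t) = of_int m * (2 * pi)" for j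
    unfolding exp_eq_1 by (auto simp: mult.commute mult.left_commute)
  then show ?thesis
    using that n(1) by blast
qed

text \<open>Otherwise only the bounded factor contributes to the pairing with \<open>f\<close>,
  which fails for a vector of length \<open>B + 1\<close> in the direction of
  \<open>f\<close>.\<close>

lemma exists_not_orthogonal:
  assumes "f \<noteq> 0"
  obtains a t where "(a, t) \<in> P" "f \<bullet> t \<noteq> 0"
proof -
  have "\<exists>a t. (a, t) \<in> P \<and> f \<bullet> t \<noteq> 0"
  proof (rule ccontr)
    assume *: "\<nexists>a t. (a, t) \<in> P \<and> f \<bullet> t \<noteq> 0"
    obtain s r c where "(c, r) \<in> P" and s: "norm s \<le> B" and eq: "((B + 1) / norm f) *\<^sub>R f = s + r"
      using cobounded[of 0 "((B + 1) / norm f) *\<^sub>R f"] by blast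
    then have "f \<bullet> (((B + 1) / norm f) *\<^sub>R f) = f \<bullet> s"
      using * by (simp add: inner_add_right)
    then have "(B + 1) * norm f = f \<bullet> s"
      using assms by (simp add: dot_square_norm power2_eq_square)
    also have "\<dots> \<le> norm f * B"
      using norm_cauchy_schwarz[of f s] s by (meson mult_left_mono norm_ge_zero order_trans)
    finally show False
      using assms by (simp add: algebra_simps)
  qed
  then show ?thesis using that by blast
qed

theorem weights_in_plane_lattice: "\<exists>\<Lambda>. plane_lattice \<Lambda> \<and> range \<mu> \<subseteq> \<Lambda>"
proof -
  obtain a t where at: "(a, t) \<in> P" "axis 1 1 \<bullet> t \<noteq> 0"
    using exists_not_orthogonal[of "axis 1 1"] by (auto simp: axis_eq_0_iff)
  then have "t $ 1 \<noteq> 0"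
    by (simp add: inner_axis')
  \<comment> \<open>Pairing \<open>s\<close> with the quarter turn of \<open>t\<close> gives
    \<open>alpha t s\<close>, so non-orthogonality becomes independence.\<close>
  then have "vector [- t $ 2, t $ 1] \<noteq> (0 :: real^2)"
    by (simp add: vec_eq_iff forall_2)
  then obtain b s where bs: "(b, s) \<in> P" "vector [- t $ 2, t $ 1] \<bullet> s \<noteq> 0"
    using exists_not_orthogonal by blast
  then have "alpha t s \<noteq> 0"
    by (simp add: alpha_def inner_vec_def sum_2)
  obtain m where m: "m > 0" "\<And>j. \<exists>k. \<mu> j \<bullet> (real m *\<^sub>R t) = of_int k * (2 * pi)"
    using integral_multiple[OF at(1)] by blast
  obtain n where n: "n > 0" "\<And>j. \<exists>k. \<mu> j \<bullet> (real n *\<^sub>R s) = of_int k * (2 * pi)"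
    using integral_multiple[OF bs(1)] by blast
  have "alpha (real m *\<^sub>R t) (real n *\<^sub>R s) \<noteq> 0"
    using m n \<open>alpha t s \<noteq> 0\<close> by (simp add: alpha_simps)
  then show ?thesis
    using m(2) n(2) by (rule plane_lattice_of_dual_vectors)
qed

end

section \<open>Weights of an oscillator group with a lattice\<close>

lemma osc_inverse:
  assumes "osc_mult \<mu> (z, a, t) y = osc_one"
  shows "y = (- z, - rot \<mu> (- t) a, - t)"
proof -
  obtain z' a' t' where y: "y = (z', a', t')" by (cases y)
  have t': "t' = - t" and a: "rot \<mu> t a' = - a" and z: "z + z' + (1/2) *\<^sub>R omega \<mu> a (rot \<mu> t a') = 0"
    using assms by (simp_all add: y osc_mult_def osc_one_def eq_neg_iff_add_eq_0 add.commute)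
  have "a' = rot \<mu> (- t) (rot \<mu> t a')"
    unfolding rot_simps(3) by (simp add: rot_simps)
  then show ?thesis
    using z by (simp add: y t' a omega_simps rot_simps eq_neg_iff_add_eq_0 add.commute)
qed

text \<open>Conjugation leaves the central part \<open>w\<close> in place up to \<open>omega\<close>
  terms, and the final factor cancels it. This is the shape of \<open>step\<close> in
  \<open>heisenberg_contraction\<close>.\<close>

lemma osc_commutator:
  "osc_mult \<mu> (osc_mult \<mu> (osc_mult \<mu> (z, a, t) (w, b, 0)) (- z, - rot \<mu> (- t) a, - t)) (- w, - b, 0) =
     (omega \<mu> a (rot \<mu> t b) - (1/2) *\<^sub>R omega \<mu> (rot \<mu> t b) b, rot \<mu> t b - b, 0)"
  using omega_swap[of \<mu> "rot \<mu> t b" a]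
  by (simp add: osc_mult_def rot_simps omega_simps)

lemma osc_weights:
  fixes \<mu> :: "'q::finite \<Rightarrow> real^2"
  assumes "admits_lattice (osc_mult \<mu>) osc_one"
  shows "\<exists>\<Lambda>. plane_lattice \<Lambda> \<and> range \<mu> \<subseteq> \<Lambda>"
proof -
  obtain \<Gamma> where \<Gamma>: "is_subgroup (osc_mult \<mu>) osc_one \<Gamma>"
    and "discrete_set \<Gamma>" "cocompact (osc_mult \<mu>) \<Gamma>"
    using assms unfolding admits_lattice_def is_lattice_in_def by blast
  have one: "osc_one \<in> \<Gamma>" and mult: "\<And>x y. x \<in> \<Gamma> \<Longrightarrow> y \<in> \<Gamma> \<Longrightarrow> osc_mult \<mu> x y \<in> \<Gamma>"
    and right_inv: "\<And>x. x \<in> \<Gamma> \<Longrightarrow> \<exists>y\<in>\<Gamma>. osc_mult \<mu> x y = osc_one"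
    using \<Gamma> by (simp_all add: is_subgroup_def)
  obtain U where "open U" and U: "U \<inter> \<Gamma> = {osc_one}"
    using \<open>discrete_set \<Gamma>\<close> one unfolding discrete_set_def by blast
  obtain K where "compact K" and K: "\<And>g. \<exists>k\<in>K. \<exists>\<gamma>\<in>\<Gamma>. g = osc_mult \<mu> k \<gamma>"
    using \<open>cocompact (osc_mult \<mu>) \<Gamma>\<close> unfolding cocompact_def by blast
  obtain B where B: "\<And>k. k \<in> K \<Longrightarrow> norm k \<le> B"
    using compact_imp_bounded[OF \<open>compact K\<close>] unfolding bounded_iff by blast
  \<comment> \<open>\<open>is_subgroup\<close> provides some right inverse within
    \<open>\<Gamma>\<close>; solving the equation identifies it with the explicit one.\<close>
  have inv: "(- z, - rot \<mu> (- t) a, - t) \<in> \<Gamma>" if "(z, a, t) \<in> \<Gamma>" for z a t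
  proof -
    from right_inv[OF that] obtain y where "y \<in> \<Gamma>" "osc_mult \<mu> (z, a, t) y = osc_one"
      by (rule bexE)
    then show ?thesis
      using osc_inverse by metis
  qed
  define P where "P = snd ` \<Gamma>"
  have P: "(a, t) \<in> P \<longleftrightarrow> (\<exists>z. (z, a, t) \<in> \<Gamma>)" for a t
    by (force simp: P_def)
  interpret cobounded_motion_group \<mu> P B
  proof
    fix a t b s assume "(a, t) \<in> P" "(b, s) \<in> P"
    then obtain z w where "(z, a, t) \<in> \<Gamma>" "(w, b, s) \<in> \<Gamma>"
      unfolding P by blast
    from mult[OF this] show "(a + rot \<mu> t b, t + s) \<in> P"
      unfolding P osc_mult_def by auto
  next
    fix a t assume "(a, t) \<in> P"
    then show "(- rot \<mu> (- t) a, - t) \<in> P"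
      unfolding P using inv by blast
  next
    fix a :: "complex^'q" and t :: "real^2"
    obtain k \<gamma> where k: "k \<in> K" "\<gamma> \<in> \<Gamma>" "(0, a, t) = osc_mult \<mu> k \<gamma>"
      using K[of "(0, a, t)"] by blast
    obtain z b s z' c r where [simp]: "k = (z, b, s)" "\<gamma> = (z', c, r)"
      by (cases k; cases \<gamma>)
    have "norm b \<le> B" "norm s \<le> B"
      using B[OF k(1)] norm_snd_le[of "(b, s)" z] norm_fst_le[of b s] norm_snd_le[of s b] by auto
    moreover have "(c, r) \<in> P" "a = b + rot \<mu> s c" "t = s + r"
      using k unfolding P by (auto simp: osc_mult_def)
    ultimately show "\<exists>b s c r. (c, r) \<in> P \<and> norm b \<le> B \<and> norm s \<le> B \<and> a = b + rot \<mu> s c \<and> t = s + r"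
      by blast
  next
    fix a t b
    assume "(a, t) \<in> P" "(b, 0) \<in> P"
      and small: "\<And>j. cmod (exp (\<i> * complex_of_real (\<mu> j \<bullet> t)) - 1) < 1"
    then obtain z w where zw: "(z, a, t) \<in> \<Gamma>" "(w, b, 0) \<in> \<Gamma>"
      unfolding P by blast
    \<comment> \<open>\<open>?i\<close> embeds the Heisenberg group as the fibre over
      \<open>t = 0\<close>; preimages carry isolation of the identity in \<open>\<Gamma>\<close>
      over to 0.\<close>
    let ?i = "\<lambda>(w, b). (w, b, 0 :: real^2)"
    show "rot \<mu> t b = b"
    proof (rule heisenberg_contraction[where S = "?i -` \<Gamma>" and U = "?i -` U" and a = a and w = w])
      show "open (?i -` U)"
        using \<open>open U\<close> by (intro open_vimage) (auto simp: case_prod_unfold intro!: continuous_intros)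
      have U': "x = osc_one" if "x \<in> U" "x \<in> \<Gamma>" for x
        using U that by blast
      have "osc_one \<in> U"
        using U by blast
      then show "0 \<in> ?i -` U"
        by (simp add: osc_one_def zero_prod_def)
      show "?i -` U \<inter> ?i -` \<Gamma> \<subseteq> {0}"
        by (auto simp: osc_one_def zero_prod_def dest!: U')
      fix w b assume "(w, b) \<in> ?i -` \<Gamma>"
      then have "(w, b, 0) \<in> \<Gamma>" "(- w, - b, 0) \<in> \<Gamma>"
        using inv[of w b 0] by (simp_all add: rot_simps)
      then have "osc_mult \<mu> (osc_mult \<mu> (osc_mult \<mu> (z, a, t) (w, b, 0)) (- z, - rot \<mu> (- t) a, - t)) (- w, - b, 0) \<in> \<Gamma>"
        by (intro mult inv zw)
      then show "(omega \<mu> a (rot \<mu> t b) - (1/2) *\<^sub>R omega \<mu> (rot \<mu> t b) b, rot \<mu> t b - b) \<in> ?i -` \<Gamma>"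
        by (simp add: osc_commutator)
    next
      show "(w, b) \<in> ?i -` \<Gamma>"
        using zw(2) by simp
    qed (rule small)
  qed
  show ?thesis
    by (rule weights_in_plane_lattice)
qed

section \<open>Weights of a group \<open>D_q\<close> with a lattice\<close>

lemma d0_inverse: "d0_mult u u' = 0 \<Longrightarrow> u' = - u"
proof -
  assume *: "d0_mult u u' = 0"
  obtain z s t z' s' t' where u: "u = (z, s, t)" "u' = (z', s', t')"
    by (cases u; cases u')
  have "t' = - t"
    using * by (simp add: u d0_mult_eq zero_prod_def eq_neg_iff_add_eq_0 add.commute)
  with * show ?thesis
    by (simp add: u d0_mult_eq zero_prod_def alpha_simps flat_simps eq_neg_iff_add_eq_0 add.commute)
       (auto simp: add_eq_0_iff)
qed

lemma D_inverse:
  assumes "D_mult \<mu> (u, a) y = D_one"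
  shows "y = (- u, - rot \<mu> (- snd (snd u)) a)"
proof -
  obtain u' a' where y: "y = (u', a')" by (cases y)
  define t where "t = snd (snd u)"
  have a: "rot \<mu> t a' = - a"
    and u: "d0_mult u u' + ((1/2) *\<^sub>R omega \<mu> a (rot \<mu> t a'), 0, 0) = 0"
    using assms by (simp_all add: y D_mult_eq D_one_def t_def eq_neg_iff_add_eq_0 add.commute)
  have "a' = rot \<mu> (- t) (- a)"
    unfolding a[symmetric] rot_simps(3) by (simp add: rot_simps)
  moreover have "u' = - u"
    using u by (intro d0_inverse) (simp add: a omega_simps flip: zero_prod_def)
  ultimately show ?thesis
    by (simp add: y rot_simps t_def)
qed

text \<open>With zero \<open>a_0\<close>-component in the second element, all \<open>flat\<close>
  and \<open>alpha\<close> terms cancel and the oscillator formula returns.\<close>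

lemma D_commutator:
  "D_mult \<mu> (D_mult \<mu> (D_mult \<mu> ((z, s, t), a) ((w, 0, 0), b)) (- (z, s, t), - rot \<mu> (- t) a)) (- (w, 0, 0), - b) =
     ((omega \<mu> a (rot \<mu> t b) - (1/2) *\<^sub>R omega \<mu> (rot \<mu> t b) b, 0, 0), rot \<mu> t b - b)"
  using omega_swap[of \<mu> "rot \<mu> t b" a]
  by (simp add: D_mult_eq d0_mult_eq rot_simps omega_simps flat_simps alpha_simps)

text \<open>A commutator with an element over \<open>t = 0\<close> has trivial \<open>a\<^sub>0\<close>-component, so that one step
  leads back to the Heisenberg group.\<close>

lemma D_commutator_a0:
  "\<exists>h. D_mult \<mu> (D_mult \<mu> (D_mult \<mu> ((z, s, t), a) ((w, r, 0), b)) (- (z, s, t), - rot \<mu> (- t) a)) (- (w, r, 0), - b) =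
     ((h, 0, 0), rot \<mu> t b - b)"
  by (simp add: D_mult_eq d0_mult_eq rot_simps flat_simps alpha_simps)

lemma D_weights:
  fixes \<mu> :: "'q::finite \<Rightarrow> real^2"
  assumes "admits_lattice (D_mult \<mu>) D_one"
  shows "\<exists>\<Lambda>. plane_lattice \<Lambda> \<and> range \<mu> \<subseteq> \<Lambda>"
proof -
  obtain \<Gamma> where \<Gamma>: "is_subgroup (D_mult \<mu>) D_one \<Gamma>"
    and "discrete_set \<Gamma>" "cocompact (D_mult \<mu>) \<Gamma>"
    using assms unfolding admits_lattice_def is_lattice_in_def by blast
  have one: "D_one \<in> \<Gamma>" and mult: "\<And>x y. x \<in> \<Gamma> \<Longrightarrow> y \<in> \<Gamma> \<Longrightarrow> D_mult \<mu> x y \<in> \<Gamma>"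
    and right_inv: "\<And>x. x \<in> \<Gamma> \<Longrightarrow> \<exists>y\<in>\<Gamma>. D_mult \<mu> x y = D_one"
    using \<Gamma> by (simp_all add: is_subgroup_def)
  obtain U where "open U" and U: "U \<inter> \<Gamma> = {D_one}"
    using \<open>discrete_set \<Gamma>\<close> one unfolding discrete_set_def by blast
  obtain K where "compact K" and K: "\<And>g. \<exists>k\<in>K. \<exists>\<gamma>\<in>\<Gamma>. g = D_mult \<mu> k \<gamma>"
    using \<open>cocompact (D_mult \<mu>) \<Gamma>\<close> unfolding cocompact_def by blast
  obtain B where B: "\<And>k. k \<in> K \<Longrightarrow> norm k \<le> B"
    using compact_imp_bounded[OF \<open>compact K\<close>] unfolding bounded_iff by blast
  have inv: "(- (z, s, t), - rot \<mu> (- t) a) \<in> \<Gamma>" if "((z, s, t), a) \<in> \<Gamma>" for z s t a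
  proof -
    from right_inv[OF that] obtain y where "y \<in> \<Gamma>" and y: "D_mult \<mu> ((z, s, t), a) y = D_one"
      by (rule bexE)
    then show ?thesis
      using D_inverse[OF y] by simp
  qed
  define P where "P = (\<lambda>(u, a). (a, snd (snd u))) ` \<Gamma>"
  have P: "(a, t) \<in> P \<longleftrightarrow> (\<exists>z s. ((z, s, t), a) \<in> \<Gamma>)" for a t
    by (force simp: P_def)
  interpret cobounded_motion_group \<mu> P B
  proof
    fix a t b s assume "(a, t) \<in> P" "(b, s) \<in> P"
    then obtain z r z' r' where "((z, r, t), a) \<in> \<Gamma>" "((z', r', s), b) \<in> \<Gamma>"
      unfolding P by blast
    from mult[OF this] show "(a + rot \<mu> t b, t + s) \<in> P"
      unfolding P by (auto simp: D_mult_eq d0_mult_eq)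
  next
    fix a t assume "(a, t) \<in> P"
    then obtain z s where "((z, s, t), a) \<in> \<Gamma>"
      unfolding P by blast
    from inv[OF this] show "(- rot \<mu> (- t) a, - t) \<in> P"
      unfolding P by auto
  next
    fix a :: "complex^'q" and t :: "real^2"
    obtain k \<gamma> where k: "k \<in> K" "\<gamma> \<in> \<Gamma>" "((0, 0, t), a) = D_mult \<mu> k \<gamma>"
      using K[of "((0, 0, t), a)"] by blast
    obtain z p s b z' p' r c where [simp]: "k = ((z, p, s), b)" "\<gamma> = ((z', p', r), c)"
      by (metis surj_pair)
    have "norm b \<le> B" "norm s \<le> B"
      using B[OF k(1)] norm_snd_le[of b "(z, p, s)"] norm_fst_le[of "(z, p, s)" b]
        norm_snd_le[of "(p, s)" z] norm_snd_le[of s p] by auto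
    moreover have "(c, r) \<in> P" "a = b + rot \<mu> s c" "t = s + r"
      using k unfolding P by (auto simp: D_mult_eq d0_mult_eq)
    ultimately show "\<exists>b s c r. (c, r) \<in> P \<and> norm b \<le> B \<and> norm s \<le> B \<and> a = b + rot \<mu> s c \<and> t = s + r"
      by blast
  next
    fix a t b
    assume "(a, t) \<in> P" "(b, 0) \<in> P"
      and small: "\<And>j. cmod (exp (\<i> * complex_of_real (\<mu> j \<bullet> t)) - 1) < 1"
    then obtain z s w r where zw: "((z, s, t), a) \<in> \<Gamma>" "((w, r, 0), b) \<in> \<Gamma>"
      unfolding P by blast
    have comm: "D_mult \<mu> (D_mult \<mu> (D_mult \<mu> ((z, s, t), a) ((w, r, 0), b)) (- (z, s, t), - rot \<mu> (- t) a))
        (- (w, r, 0), - b) \<in> \<Gamma>" if "((w, r, 0), b) \<in> \<Gamma>" for w r b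
      using inv[OF that] that by (intro mult inv zw) (simp_all add: rot_simps)
    \<comment> \<open>The lift of \<open>b\<close> may have \<open>a_0\<close>-component
      \<open>r\<close>; one commutator removes it, so the contraction starts from
      \<open>rot \<mu> t b - b\<close> instead of \<open>b\<close>.\<close>
    obtain h where h: "((h, 0, 0), rot \<mu> t b - b) \<in> \<Gamma>"
      using comm[OF zw(2)] D_commutator_a0 by metis
    let ?i = "\<lambda>(w, b). ((w, 0 :: real, 0 :: real^2), b)"
    have "rot \<mu> t (rot \<mu> t b - b) = rot \<mu> t b - b"
    proof (rule heisenberg_contraction[where S = "?i -` \<Gamma>" and U = "?i -` U" and a = a and w = h])
      show "open (?i -` U)"
        using \<open>open U\<close> by (intro open_vimage) (auto simp: case_prod_unfold intro!: continuous_intros)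
      have U': "x = D_one" if "x \<in> U" "x \<in> \<Gamma>" for x
        using U that by blast
      have "D_one \<in> U"
        using U by blast
      then show "0 \<in> ?i -` U"
        by (simp add: D_one_def zero_prod_def)
      show "?i -` U \<inter> ?i -` \<Gamma> \<subseteq> {0}"
        by (auto simp: D_one_def zero_prod_def dest!: U')
      fix w b assume "(w, b) \<in> ?i -` \<Gamma>"
      then have "((w, 0, 0), b) \<in> \<Gamma>"
        by simp
      from comm[OF this] show "(omega \<mu> a (rot \<mu> t b) - (1/2) *\<^sub>R omega \<mu> (rot \<mu> t b) b, rot \<mu> t b - b) \<in> ?i -` \<Gamma>"
        unfolding D_commutator by simp
    next
      show "(h, rot \<mu> t b - b) \<in> ?i -` \<Gamma>"
        using h by simp
    qed (rule small)
    then have eq: "rot \<mu> t (rot \<mu> t b - b) $ j = (rot \<mu> t b - b) $ j" for j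
      by simp
    show "rot \<mu> t b = b"
    proof -
      \<comment> \<open>The extra commutator costs one more factor
        \<open>exp (\<i> * \<mu> j \<bullet> t) - 1\<close>; its square kills \<open>b $ j\<close>,
        hence so does the factor itself.\<close>
      have "(exp (\<i> * complex_of_real (\<mu> j \<bullet> t)) - 1)\<^sup>2 * b $ j = 0" for j
        using eq[of j] by (simp add: rot_nth power2_eq_square algebra_simps)
      then have "exp (\<i> * complex_of_real (\<mu> j \<bullet> t)) * b $ j = b $ j" for j
        by (metis diff_eq_eq add_0 mult_1 mult_eq_0_iff power_eq_0_iff mult_zero_right)
      then show ?thesis
        by (simp add: vec_eq_iff rot_nth)
    qed
  qed
  show ?thesis
    by (rule weights_in_plane_lattice)
qed

theorem theorem2:
  fixes \<mu> :: "'q::finite \<Rightarrow> real^2"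
  shows "((\<forall>j. \<mu> j \<noteq> 0) \<and> \<not> in_two_lines \<mu> \<longrightarrow>
            (admits_lattice (osc_mult \<mu>) osc_one \<longleftrightarrow>
             (\<exists>\<Lambda>. plane_lattice \<Lambda> \<and> range \<mu> \<subseteq> \<Lambda>)))
       \<and> ((\<forall>j. \<mu> j \<noteq> 0) \<longrightarrow>
            (admits_lattice (D_mult \<mu>) D_one \<longleftrightarrow>
             (\<exists>\<Lambda>. plane_lattice \<Lambda> \<and> range \<mu> \<subseteq> \<Lambda>)))
       \<and> admits_lattice d0_mult d0_one"
proof -
  have "admits_lattice (osc_mult \<mu>) osc_one \<longleftrightarrow> (\<exists>\<Lambda>. plane_lattice \<Lambda> \<and> range \<mu> \<subseteq> \<Lambda>)"
    using osc_weights osc_lattice unfolding plane_lattice_iff by metis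
  moreover have "admits_lattice (D_mult \<mu>) D_one \<longleftrightarrow> (\<exists>\<Lambda>. plane_lattice \<Lambda> \<and> range \<mu> \<subseteq> \<Lambda>)"
    using D_weights D_lattice unfolding plane_lattice_iff by metis
  ultimately show ?thesis
    using D0_lattice by blast
qed

end
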